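(* Let $G$ be a $C_4$-free graph with minimum degree $k$, and suppose $p=p(k)$ satisfies $pk\to\infty$ as $k\to\infty$. Then with high probability (i.e. with probability tending to $1$ as $k\to\infty$) the random subgraph $G_p$ contains a cycle of length at least $(1-o(1))k^2$.
   Context: A graph is $C_4$-free if it contains no cycle of length $4$ as a (not necessarily induced) subgraph. For a finite graph $G$ and $p\in[0,1]$, $G_p$ is the random spanning subgraph of $G$ obtained by keeping each edge of $G$ independently with probability $p$. The statement is uniform over all such $G$: for every $\eta>0$, the probability that $G_p$ contains a cycle of length at least $(1-\eta)k^2$ tends to $1$ as $k\to\infty$. *)

theory Defs
  imports "HOL-Probability.Probability"
begin

definition simple_graph :: "'a set \<Rightarrow> 'a set set \<Rightarrow> bool" where
  "simple_graph V E \<longleftrightarrow> (\<forall>e\<in>E. e \<subseteq> V \<and> card e = 2)"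

definition vertex_degree :: "'a set set \<Rightarrow> 'a \<Rightarrow> nat" where
  "vertex_degree E v = card {e \<in> E. v \<in> e}"

(* Meaningful only for finite, nonempty V. *)
definition min_degree :: "'a set \<Rightarrow> 'a set set \<Rightarrow> nat" where
  "min_degree V E = Min (vertex_degree E ` V)"

(* A cycle is given by its cyclic sequence of distinct vertices, so its length
   (the number of its edges) is the length of the list. *)
definition is_cycle :: "'a set set \<Rightarrow> 'a list \<Rightarrow> bool" where
  "is_cycle E xs \<longleftrightarrow> length xs \<ge> 3 \<and> distinct xs \<and>
     (\<forall>i<length xs. {xs ! i, xs ! (Suc i mod length xs)} \<in> E)"

definition C4_free :: "'a set set \<Rightarrow> bool" where
  "C4_free E \<longleftrightarrow> \<not> (\<exists>xs. is_cycle E xs \<and> length xs = 4)"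

(* Distribution of the edge set of the random spanning subgraph; the vertex set is unchanged. *)
definition random_subgraph :: "'a set set \<Rightarrow> real \<Rightarrow> 'a set set pmf" where
  "random_subgraph E p =
     map_pmf (\<lambda>keep. {e \<in> E. keep e}) (Pi_pmf E False (\<lambda>_. bernoulli_pmf p))"

end

theory Submission
  imports Defs
begin

text \<open>
  Let \<open>1 - p = (1 - q)\<^sup>2\<close>, so that the random subgraph is the union of two independent copies \<open>F\<close>, \<open>F'\<close>
  with edge probability \<open>q \<ge> p / 2\<close>. Depth-first search on \<open>F\<close> finds at most \<open>n\<close> edges, hence with high
  probability it queries only \<open>o(n k)\<close> edges, and every edge of \<open>G\<close> that was not queried joins a vertex to
  one of its ancestors in the search forest. So almost every vertex is full: almost all of its at least
  \<open>k\<close> edges join it to ancestors or descendants.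

  If some vertex has \<open>\<delta> k\<close> such edges spanning \<open>(1 - \<eta>) k\<^sup>2\<close> levels, one of them is in \<open>F'\<close> and closes a long
  cycle. Otherwise the edges of a full vertex are short. As a \<open>C\<^sub>4\<close>-free graph in which many vertices have
  almost \<open>k\<close> neighbours in a set \<open>Y\<close> satisfies \<open>|Y| \<ge> (1 - o(1)) k\<^sup>2\<close>, the vertices with few descendants are
  rare: those visited within a short time interval share their close ancestors. Hence the forest
  consists mostly of long paths with little hanging off them. A short segment of such a path cannot send
  almost all of its edges downwards, again by \<open>C\<^sub>4\<close>-freeness, so it contains a vertex with \<open>\<delta> k\<close> edges upwards
  that leave the segment. For boundedly many segments one of these edges is in \<open>F'\<close>, and these chords together
  with the path form a cycle that covers half of the path.
\<close>

section \<open>Graphs without four-cycles\<close>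

definition nbrs :: "'a set set \<Rightarrow> 'a \<Rightarrow> 'a set" where
  "nbrs E v = {u. {v, u} \<in> E}"

lemma nbrs_subset:
  assumes "simple_graph V E" shows "nbrs E v \<subseteq> V"
  using assms by (auto simp: nbrs_def simple_graph_def)

lemma not_in_own_nbrs:
  assumes "simple_graph V E" shows "v \<notin> nbrs E v"
  using assms by (force simp: nbrs_def simple_graph_def)

lemma vertex_degree_eq_card_nbrs:
  assumes "simple_graph V E"
  shows "vertex_degree E v = card (nbrs E v)"
proof -
  have "inj_on (\<lambda>u. {v, u}) (nbrs E v)"
    by (auto simp: inj_on_def doubleton_eq_iff)
  moreover have "(\<lambda>u. {v, u}) ` nbrs E v = {e \<in> E. v \<in> e}"
  proof (intro equalityI subsetI)
    fix e assume e: "e \<in> {e \<in> E. v \<in> e}"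
    then have "card e = 2" using assms by (auto simp: simple_graph_def)
    then obtain a b where ab: "e = {a, b}" "a \<noteq> b" by (meson card_2_iff)
    with e have "v = a \<or> v = b" by auto
    then show "e \<in> (\<lambda>u. {v, u}) ` nbrs E v"
      using e ab by (auto simp: nbrs_def insert_commute)
  qed (auto simp: nbrs_def)
  ultimately show ?thesis
    unfolding vertex_degree_def by (metis card_image)
qed

lemma min_degree_le_card_nbrs:
  assumes "finite V" "simple_graph V E" "v \<in> V"
  shows "min_degree V E \<le> card (nbrs E v)"
  using assms by (auto simp: min_degree_def vertex_degree_eq_card_nbrs[symmetric])

lemma is_cycleI:
  assumes "3 \<le> length xs" "distinct xs" "successively (\<lambda>a b. {a, b} \<in> E) xs"
    and "{last xs, hd xs} \<in> E"
  shows "is_cycle E xs"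
  unfolding is_cycle_def
proof (intro conjI allI impI)
  fix i assume i: "i < length xs"
  show "{xs ! i, xs ! (Suc i mod length xs)} \<in> E"
  proof (cases "Suc i = length xs")
    case True
    then have "xs \<noteq> []" "length xs - 1 = i" using i by auto
    then have "xs ! i = last xs" "xs ! 0 = hd xs"
      by (simp_all add: last_conv_nth hd_conv_nth)
    with True show ?thesis using assms(4) by simp
  next
    case False
    with i show ?thesis using assms(3) by (simp add: successively_conv_nth)
  qed
qed (use assms in auto)

text \<open>Two common neighbours would close a four-cycle that alternates between them and
  \<open>v\<close>, \<open>v'\<close>.\<close>

lemma C4_free_common_nbrs:
  assumes "finite V" "simple_graph V E" "C4_free E" "v \<noteq> v'"
  shows "card (nbrs E v \<inter> nbrs E v') \<le> 1"
proof (rule ccontr)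
  assume "\<not> ?thesis"
  moreover have "finite (nbrs E v \<inter> nbrs E v')"
    using nbrs_subset[OF assms(2)] assms(1) by (meson finite_Int finite_subset)
  ultimately obtain u u' where u: "u \<in> nbrs E v \<inter> nbrs E v'" "u' \<in> nbrs E v \<inter> nbrs E v'" "u \<noteq> u'"
    by (metis One_nat_def card_le_Suc0_iff_eq)
  have "is_cycle E [v, u, v', u']"
    using u assms(4) not_in_own_nbrs[OF assms(2)]
    by (intro is_cycleI) (auto simp: nbrs_def insert_commute)
  then show False using assms(3) unfolding C4_free_def by fastforce
qed

text \<open>The Kovari-Sos-Turan argument: count the pairs of \<open>X\<close> through their common elements in \<open>Y\<close>.\<close>

lemma card_mult_le_of_intersections:
  fixes A :: "'a \<Rightarrow> 'b set" and \<kappa> :: nat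
  assumes fX: "finite X" and fY: "finite Y"
    and AY: "\<And>v. v \<in> X \<Longrightarrow> A v \<subseteq> Y" and Acard: "\<And>v. v \<in> X \<Longrightarrow> \<kappa> \<le> card (A v)"
    and inter: "\<And>v v'. v \<in> X \<Longrightarrow> v' \<in> X \<Longrightarrow> v \<noteq> v' \<Longrightarrow> card (A v \<inter> A v') \<le> 1"
  shows "\<kappa>\<^sup>2 * card X \<le> card Y * (\<kappa> + card X)"
proof (cases "X = {}")
  case False
  \<comment> \<open>Trimming each \<open>A v\<close> to exactly \<open>\<kappa>\<close> elements
    makes the count of incidences an equality, while the intersections only shrink.\<close>
  have "\<forall>v\<in>X. \<exists>B. B \<subseteq> A v \<and> card B = \<kappa> \<and> finite B"
    by (meson Acard obtain_subset_with_card_n)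
  then obtain B where B: "\<And>v. v \<in> X \<Longrightarrow> B v \<subseteq> A v \<and> card (B v) = \<kappa> \<and> finite (B v)"
    by metis
  define d where "d y = (\<Sum>v\<in>X. if y \<in> B v then 1 else 0 :: nat)" for y
  have BY: "v \<in> X \<Longrightarrow> Y \<inter> B v = B v" for v using B AY by blast
  have e: "(\<Sum>y\<in>Y. d y) = \<kappa> * card X"
  proof -
    have "(\<Sum>y\<in>Y. d y) = (\<Sum>v\<in>X. \<Sum>y\<in>Y. if y \<in> B v then 1 else 0)"
      unfolding d_def by (rule sum.swap)
    also have "\<dots> = (\<Sum>v\<in>X. \<kappa>)"
      using B fY by (intro sum.cong refl) (simp add: sum.inter_restrict[symmetric] BY)
    finally show ?thesis by simp
  qed
  have d2: "(\<Sum>y\<in>Y. (d y)\<^sup>2) \<le> \<kappa> * card X + (card X)\<^sup>2"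
  proof -
    have "(\<Sum>y\<in>Y. (d y)\<^sup>2) = (\<Sum>y\<in>Y. \<Sum>v\<in>X. \<Sum>v'\<in>X. if y \<in> B v \<inter> B v' then 1 else 0)"
      unfolding d_def power2_eq_square sum_product by (intro sum.cong refl) auto
    also have "\<dots> = (\<Sum>v\<in>X. \<Sum>y\<in>Y. \<Sum>v'\<in>X. if y \<in> B v \<inter> B v' then 1 else 0)"
      by (rule sum.swap)
    also have "\<dots> = (\<Sum>v\<in>X. \<Sum>v'\<in>X. \<Sum>y\<in>Y. if y \<in> B v \<inter> B v' then 1 else 0)"
      by (intro sum.cong refl sum.swap)
    also have "\<dots> = (\<Sum>v\<in>X. \<Sum>v'\<in>X. card (B v \<inter> B v'))"
    proof (intro sum.cong refl)
      fix v v' assume "v \<in> X" "v' \<in> X"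
      then have "Y \<inter> (B v \<inter> B v') = B v \<inter> B v'" using BY by blast
      then show "(\<Sum>y\<in>Y. if y \<in> B v \<inter> B v' then 1 else 0) = card (B v \<inter> B v')"
        using fY by (simp only: sum.inter_restrict[symmetric]) simp
    qed
    \<comment> \<open>Diagonal pairs contribute \<open>\<kappa>\<close>, all others at most 1;
      allowing the 1 on the diagonal too keeps the sum simple.\<close>
    also have "\<dots> \<le> (\<Sum>v\<in>X. \<Sum>v'\<in>X. (if v' = v then \<kappa> else 0) + 1)"
    proof (intro sum_mono)
      fix v v' assume v: "v \<in> X" "v' \<in> X"
      show "card (B v \<inter> B v') \<le> (if v' = v then \<kappa> else 0) + 1"
      proof (cases "v' = v")
        case False
        have "card (B v \<inter> B v') \<le> card (A v \<inter> A v')"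
          using v B AY fY by (intro card_mono) (meson finite_Int finite_subset, blast)
        then show ?thesis using inter[of v v'] v False by simp
      qed (use v B in auto)
    qed
    also have "\<dots> = \<kappa> * card X + (card X)\<^sup>2"
      unfolding sum.distrib using fX by (simp add: power2_eq_square)
    finally show ?thesis .
  qed
  \<comment> \<open>Cauchy-Schwarz against the constant 1 compares the two moments of the degrees
    \<open>d y\<close>; a factor \<open>card X\<close> cancels at the end.\<close>
  have "(\<Sum>y\<in>Y. real (d y))\<^sup>2 \<le> (\<Sum>y\<in>Y. (real (d y))\<^sup>2) * (\<Sum>y\<in>Y. 1\<^sup>2)"
    using Cauchy_Schwarz_ineq_sum[of "\<lambda>y. real (d y)" "\<lambda>_. 1" Y] by simp
  then have "real ((\<Sum>y\<in>Y. d y)\<^sup>2) \<le> real ((\<Sum>y\<in>Y. (d y)\<^sup>2) * card Y)" by simp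
  then have "(\<Sum>y\<in>Y. d y)\<^sup>2 \<le> (\<Sum>y\<in>Y. (d y)\<^sup>2) * card Y" by linarith
  also have "\<dots> \<le> (\<kappa> * card X + (card X)\<^sup>2) * card Y" using d2 by simp
  finally have "(\<kappa>\<^sup>2 * card X) * card X \<le> (card Y * (\<kappa> + card X)) * card X"
    unfolding e by (simp add: power2_eq_square algebra_simps)
  then show ?thesis using False fX by (simp add: card_gt_0_iff)
qed simp

section \<open>The stack of a depth-first search\<close>

text \<open>The search forest is encoded by its successive stacks, root first. A pushed vertex has
  never been on the stack before, so every vertex enters exactly once, and the stack at that moment
  is its path from the root.\<close>

locale tour =
  fixes st :: "nat \<Rightarrow> 'a list" and T :: nat and V :: "'a set"
  assumes st_0: "st 0 = []"
    and st_Suc: "i < T \<Longrightarrow>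
      (\<exists>v\<in>V. v \<notin> (\<Union>j\<le>i. set (st j)) \<and> st (Suc i) = st i @ [v]) \<or>
      (st i \<noteq> [] \<and> st (Suc i) = butlast (st i))"
    and cover: "V \<subseteq> (\<Union>j\<le>T. set (st j))"
    and finite_V: "finite V"
begin

definition push :: "'a \<Rightarrow> nat" where "push v = (LEAST j. v \<in> set (st j))"
text \<open>For \<open>v\<close> in \<open>V\<close> this is the path from the root to
  \<open>v\<close>, both ends included, so \<open>u \<in> set (stem v)\<close> says that
  \<open>u\<close> is \<open>v\<close> or an ancestor of it. As \<open>dep\<close> is the length of
  this path, roots have depth 1 and \<open>v\<close> sits at index \<open>dep v - 1\<close>.\<close>

definition stem :: "'a \<Rightarrow> 'a list" where "stem v = st (push v)"
definition dep :: "'a \<Rightarrow> nat" where "dep v = length (stem v)"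

lemma st_cases:
  assumes "i < T"
  obtains (push) v where "v \<in> V" "\<And>j. j \<le> i \<Longrightarrow> v \<notin> set (st j)" "st (Suc i) = st i @ [v]"
        | (pop) "st i \<noteq> []" "st (Suc i) = butlast (st i)"
  using st_Suc[OF assms] by blast

lemma distinct_st: "j \<le> T \<Longrightarrow> distinct (st j)"
proof (induction j)
  case (Suc j)
  then have "j < T" by simp
  then show ?case using Suc by (cases rule: st_cases) (auto simp: distinct_butlast)
qed (simp add: st_0)

lemma set_st: "j \<le> T \<Longrightarrow> set (st j) \<subseteq> V"
proof (induction j)
  case (Suc j)
  then have "j < T" by simp
  then show ?case using Suc by (cases rule: st_cases) (auto dest: in_set_butlastD)
qed (simp add: st_0)

lemma push_le: "v \<in> set (st j) \<Longrightarrow> push v \<le> j"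
  unfolding push_def by (rule Least_le)

lemma mem_st_push: "v \<in> V \<Longrightarrow> v \<in> set (st (push v))"
proof -
  assume "v \<in> V"
  then obtain j where "v \<in> set (st j)" using cover by auto
  then show ?thesis unfolding push_def by (rule LeastI)
qed

lemma push_le_T: "v \<in> V \<Longrightarrow> push v \<le> T"
proof -
  assume "v \<in> V"
  then obtain j where "j \<le> T" "v \<in> set (st j)" using cover by auto
  then show ?thesis using push_le[of v j] by linarith
qed

text \<open>A push appends a fresh vertex, whose stem is the new stack itself, and a pop only
  shortens the stack. Hence whatever lies beneath a vertex on any stack is its root path.\<close>

lemma stem_st: "j \<le> T \<Longrightarrow> i < length (st j) \<Longrightarrow> stem (st j ! i) = take (Suc i) (st j)"
proof (induction j arbitrary: i)
  case (Suc j)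
  then have "j < T" by simp
  then show ?case
  proof (cases rule: st_cases)
    case (push v)
    show ?thesis
    proof (cases "i < length (st j)")
      case True
      then show ?thesis using Suc push by (simp add: nth_append)
    next
      case False
      then have i: "i = length (st j)" using push Suc.prems by simp
      have "push v = Suc j" unfolding push_def
      proof (rule Least_equality)
        show "v \<in> set (st (Suc j))" using push by simp
        show "Suc j \<le> y" if "v \<in> set (st y)" for y
          using that push(2)[of y] by (meson not_less_eq_eq)
      qed
      then show ?thesis using i push by (simp add: stem_def)
    qed
  next
    case pop
    then have i: "i < length (st j) - 1" using Suc.prems by simp
    then show ?thesis using Suc pop by (simp add: nth_butlast take_butlast)
  qed
qed (simp add: st_0)

lemma stem_nth:
  assumes "v \<in> V" "i < dep v" shows "stem (stem v ! i) = take (Suc i) (stem v)"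
  using stem_st[of "push v" i] push_le_T[OF assms(1)] assms(2) by (simp add: stem_def dep_def)

lemma mem_stem: "v \<in> V \<Longrightarrow> v \<in> set (stem v)"
  using mem_st_push by (simp add: stem_def)

lemma set_stem: "v \<in> V \<Longrightarrow> set (stem v) \<subseteq> V"
  using set_st push_le_T by (simp add: stem_def)

lemma distinct_stem: "v \<in> V \<Longrightarrow> distinct (stem v)"
  using distinct_st push_le_T by (simp add: stem_def)

lemma push_mono: "u \<in> set (stem v) \<Longrightarrow> push u \<le> push v"
  unfolding stem_def by (rule push_le)

lemma stem_eq_take:
  assumes "j \<le> T" "u \<in> set (st j)"
  shows "stem u = take (dep u) (st j)" "0 < dep u" "dep u \<le> length (st j)" "st j ! (dep u - 1) = u"
proof -
  obtain i where i: "i < length (st j)" "st j ! i = u" using assms by (meson in_set_conv_nth)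
  have p: "stem u = take (Suc i) (st j)" using stem_st[OF assms(1) i(1)] i by simp
  then have d: "dep u = Suc i" using i by (simp add: dep_def)
  show "stem u = take (dep u) (st j)" "0 < dep u" "dep u \<le> length (st j)" "st j ! (dep u - 1) = u"
    using p d i by auto
qed

lemma stem_ancestor:
  assumes "v \<in> V" "u \<in> set (stem v)"
  shows "stem u = take (dep u) (stem v)" "0 < dep u" "dep u \<le> dep v" "stem v ! (dep u - 1) = u"
proof -
  note * = stem_eq_take[OF push_le_T[OF assms(1)], of u, folded stem_def, folded dep_def, OF assms(2)]
  show "stem u = take (dep u) (stem v)" by (fact *(1))
  show "0 < dep u" by (fact *(2))
  show "dep u \<le> dep v" by (fact *(3))
  show "stem v ! (dep u - 1) = u" by (fact *(4))
qed

lemma stem_last: "v \<in> V \<Longrightarrow> stem v ! (dep v - 1) = v"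
  by (rule stem_ancestor(4)[OF _ mem_stem])

lemma dep_pos: "v \<in> V \<Longrightarrow> 0 < dep v"
  by (rule stem_ancestor(2)[OF _ mem_stem])

lemma dep_stem_nth:
  assumes "v \<in> V" "i < dep v" shows "dep (stem v ! i) = Suc i"
  using stem_nth[OF assms] assms by (simp add: dep_def)

lemma ancestor_trans:
  assumes "v \<in> V" "u \<in> set (stem v)" "x \<in> set (stem u)" shows "x \<in> set (stem v)"
  using stem_ancestor(1)[OF assms(1,2)] assms(3) by (metis in_set_takeD)

text \<open>The stems of \<open>u\<close> and \<open>x\<close> are both prefixes of
  \<open>stem v\<close>, so the shorter one is a prefix of the longer one.\<close>

lemma ancestor_linear:
  assumes "v \<in> V" "u \<in> set (stem v)" "x \<in> set (stem v)" "dep x \<le> dep u"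
  shows "x \<in> set (stem u)"
proof -
  have u: "u \<in> V" using assms(1,2) set_stem by blast
  have "stem x = take (dep x) (stem u)"
    using stem_ancestor(1)[OF assms(1,2)] stem_ancestor(1)[OF assms(1,3)] assms(4)
    by (simp add: min_absorb1)
  moreover have "x \<in> set (stem x)" using assms set_stem by (intro mem_stem) blast
  ultimately show ?thesis by (metis in_set_takeD)
qed

lemma ancestor_antisym:
  assumes "v \<in> V" "u \<in> set (stem v)" "dep u = dep v" shows "u = v"
  using stem_ancestor(4)[OF assms(1,2)] stem_last[OF assms(1)] assms(3) by simp

lemma ancestor_dep_less:
  assumes "v \<in> V" "u \<in> set (stem v)" "u \<noteq> v" shows "dep u < dep v"
  using stem_ancestor(3)[OF assms(1,2)] ancestor_antisym[OF assms(1,2)] assms(3) by linarith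

text \<open>A popped vertex never returns, because pushes use fresh vertices only. So the times that
  a vertex spends on the stack form an interval.\<close>

lemma persist:
  assumes "v \<in> set (st a)" "a \<le> b" "b \<le> c" "c \<le> T" "v \<in> set (st c)"
  shows "v \<in> set (st b)"
  using assms(3,4,5)
proof (induction c rule: dec_induct)
  case (step c)
  then have "c < T" by simp
  then show ?case
  proof (cases rule: st_cases)
    case (push x)
    have "x \<noteq> v" using push(2)[of a] assms(1,2) step.hyps by auto
    then show ?thesis using step push by auto
  next
    case pop
    then show ?thesis using step by (auto dest: in_set_butlastD)
  qed
qed

text \<open>A push raises the stack length by one and a pop lowers it by one; this is the resulting
  balance, arranged so that no stack lengths are subtracted.\<close>

lemma card_pushed:
  assumes "a \<le> b" "b \<le> T"
  shows "length (st b) + (b - a) = length (st a) + 2 * card {v \<in> V. a < push v \<and> push v \<le> b}"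
  using assms
proof (induction b rule: dec_induct)
  case base
  then show ?case by (auto simp: card_eq_0_iff)
next
  case (step b)
  let ?P = "\<lambda>b. {v \<in> V. a < push v \<and> push v \<le> b}"
  from step have "b < T" by simp
  then show ?case
  proof (cases rule: st_cases)
    case (push x)
    have px: "push x = Suc b" unfolding push_def
    proof (rule Least_equality)
      show "x \<in> set (st (Suc b))" using push by simp
      show "Suc b \<le> y" if "x \<in> set (st y)" for y
        using that push(2)[of y] by (meson not_less_eq_eq)
    qed
    have ux: "v = x" if "v \<in> V" "push v = Suc b" for v
    proof -
      have "v \<in> set (st b @ [x])" using mem_st_push[OF that(1)] that(2) push(3) by metis
      moreover have "v \<notin> set (st b)" using push_le[of v b] that(2) by auto
      ultimately show ?thesis by simp
    qed
    have "?P (Suc b) = insert x (?P b)"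
    proof (rule set_eqI)
      fix v
      show "v \<in> ?P (Suc b) \<longleftrightarrow> v \<in> insert x (?P b)"
      proof (cases "v = x")
        case True
        then show ?thesis using push(1) px step.hyps(1) by simp
      next
        case False
        then have "\<not> (v \<in> V \<and> push v = Suc b)" using ux by blast
        then show ?thesis using False by (auto simp: le_Suc_eq)
      qed
    qed
    moreover have "x \<notin> ?P b" using px by auto
    ultimately have "card (?P (Suc b)) = Suc (card (?P b))" using finite_V by simp
    then show ?thesis using step.IH push(3) \<open>b < T\<close> step.hyps(1) by simp
  next
    case pop
    have "push v \<noteq> Suc b" if "v \<in> V" for v
    proof
      assume "push v = Suc b"
      then have "v \<in> set (butlast (st b))" using mem_st_push[OF that] pop(2) by metis
      then show False using push_le[of v b] \<open>push v = Suc b\<close> by (auto dest: in_set_butlastD)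
    qed
    then have "?P (Suc b) = ?P b" by (auto simp: le_Suc_eq)
    moreover have "length (st b) > 0" using pop by simp
    moreover have "length (st b) = Suc (length (st (Suc b)))" using pop by simp
    ultimately show ?thesis using step.IH \<open>b < T\<close> step.hyps(1) by (simp add: Suc_diff_le)
  qed
qed

lemma T_le: "T \<le> 2 * card V"
proof -
  have "T \<le> 2 * card {v \<in> V. 0 < push v \<and> push v \<le> T}"
    using card_pushed[of 0 T] by (simp add: st_0)
  also have "card {v \<in> V. 0 < push v \<and> push v \<le> T} \<le> card V"
    using finite_V by (intro card_mono) auto
  finally show ?thesis by simp
qed

text \<open>Each step pushes or pops one vertex, so \<open>l\<close> steps affect only \<open>l\<close> vertices above the common part \<open>c\<close>.\<close>

lemma window:
  assumes "t + l \<le> T"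
  shows "\<exists>c S. finite S \<and> card S \<le> l \<and> (\<forall>\<tau>\<in>{t..t + l}. \<exists>r. st \<tau> = c @ r \<and> set r \<subseteq> S)"
  using assms
proof (induction l)
  case 0
  show ?case by (rule exI[of _ "st t"], rule exI[of _ "{}"]) auto
next
  case (Suc l)
  then obtain c S where S: "finite S" "card S \<le> l"
    and cS: "\<forall>\<tau>\<in>{t..t + l}. \<exists>r. st \<tau> = c @ r \<and> set r \<subseteq> S" by auto
  have split: "{t..t + Suc l} = insert (Suc (t + l)) {t..t + l}" by auto
  obtain r where r: "st (t + l) = c @ r" "set r \<subseteq> S" using cS[rule_format, of "t + l"] by auto
  have "t + l < T" using Suc.prems by simp
  then show ?case
  proof (cases rule: st_cases)
    case (push v)
    have "card (insert v S) \<le> Suc l" using S by (simp add: card_insert_if)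
    moreover have "\<exists>r. st \<tau> = c @ r \<and> set r \<subseteq> insert v S" if "\<tau> \<in> {t..t + Suc l}" for \<tau>
      using that cS r push unfolding split by fastforce
    ultimately show ?thesis using S by blast
  next
    case pop
    show ?thesis
    proof (cases "r = []")
      case False
      then have "st (Suc (t + l)) = c @ butlast r" "set (butlast r) \<subseteq> S"
        using pop r by (auto simp: butlast_append dest: in_set_butlastD)
      then have "\<exists>r. st \<tau> = c @ r \<and> set r \<subseteq> S" if "\<tau> \<in> {t..t + Suc l}" for \<tau>
        using that cS unfolding split by blast
      then show ?thesis using S by (meson le_SucI)
    next
      \<comment> \<open>This pop reaches into the common part: the top vertex of \<open>c\<close>
        moves to \<open>S\<close>, at the price of one more element.\<close>
      case True
      then have c: "c \<noteq> []" "st (Suc (t + l)) = butlast c"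
        using pop r by auto
      have "\<exists>r. st \<tau> = butlast c @ r \<and> set r \<subseteq> insert (last c) S" if "\<tau> \<in> {t..t + Suc l}" for \<tau>
      proof (cases "\<tau> = Suc (t + l)")
        case False
        then have "\<tau> \<in> {t..t + l}" using that by auto
        then obtain r' where "st \<tau> = c @ r'" "set r' \<subseteq> S" using cS by blast
        moreover have "butlast c @ last c # r' = c @ r'"
          using append_butlast_last_id[OF c(1)] by (metis append.assoc append_Cons append_Nil)
        ultimately show ?thesis by (intro exI[of _ "last c # r'"]) auto
      next
        case True
        then show ?thesis using c(2) by (intro exI[of _ "[]"]) simp
      qed
      moreover have "card (insert (last c) S) \<le> Suc l" using S by (simp add: card_insert_if)
      ultimately show ?thesis using S(1)
        by (intro exI[of _ "butlast c"] exI[of _ "insert (last c) S"]) simp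
    qed
  qed
qed

end

section \<open>Search forests of graphs without four-cycles\<close>

lemma nth_mem_set_drop:
  assumes "n \<le> i" "i < length xs" shows "xs ! i \<in> set (drop n xs)"
proof -
  have "drop n xs ! (i - n) = xs ! i" "i - n < length (drop n xs)" using assms by auto
  then show ?thesis by (metis nth_mem)
qed

context tour begin

definition comparable :: "'a \<Rightarrow> 'a \<Rightarrow> bool" where
  "comparable u v \<longleftrightarrow> u \<in> set (stem v) \<or> v \<in> set (stem u)"

end

text \<open>\<open>N\<close> stands for the failed queries, \<open>m\<close> for the desired cycle
  length, \<open>e\<close> for a small fraction of \<open>k\<close>, \<open>w\<close> for the scale
  of time windows and path segments, and \<open>M\<close> for the length of the path that is sought.
  \<open>few_long\<close> excludes the easy case of a vertex with many long chords.
  \<open>kst\<close> says that \<open>b\<close> vertices with \<open>k - 3 * e\<close> neighbours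
  each in a set of size \<open>m + 9 * w\<close> violate the Kovari-Sos-Turan bound.\<close>

locale C4_free_tour = tour st T V for st :: "nat \<Rightarrow> 'a list" and T V +
  fixes E N :: "'a set set" and k e m w b M :: nat
  assumes simple: "simple_graph V E" and C4: "C4_free E"
    and deg: "v \<in> V \<Longrightarrow> k \<le> card (nbrs E v)"
    and N_sub: "N \<subseteq> E"
    and comparable_or_N: "{u, v} \<in> E \<Longrightarrow> {u, v} \<in> N \<or> comparable u v"
    and few_long: "v \<in> V \<Longrightarrow>
      card {u \<in> nbrs E v. comparable u v \<and> (dep u + m \<le> dep v \<or> dep v + m \<le> dep u)} < e"
    and kst: "(m + 9 * w) * ((k - 3 * e) + b) < (k - 3 * e)\<^sup>2 * b"
    and w_pos: "0 < w" and m_pos: "0 < m" and b_le: "2 * b \<le> w"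
begin

definition full :: "'a \<Rightarrow> bool" where
  "full v \<longleftrightarrow> k \<le> card {u \<in> nbrs E v. comparable u v} + e"

text \<open>Poverty is measured by the time until the last descendant is found, which is at most twice the
  number of descendants.\<close>

definition poor :: "'a \<Rightarrow> bool" where
  "poor v \<longleftrightarrow> (\<forall>u\<in>V. v \<in> set (stem u) \<longrightarrow> push u \<le> push v + 2 * w)"

definition minimal_rich :: "'a \<Rightarrow> bool" where
  "minimal_rich x \<longleftrightarrow> \<not> poor x \<and> (\<forall>u\<in>V. x \<in> set (stem u) \<and> u \<noteq> x \<longrightarrow> poor u)"

definition low :: "'a \<Rightarrow> bool" where
  "low v \<longleftrightarrow> \<not> (\<exists>u\<in>V. v \<in> set (stem u) \<and> dep u = dep v + M)"

definition below :: "'a \<Rightarrow> 'a set" where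
  "below v = {u \<in> V. v \<in> set (stem u) \<and> dep u \<le> dep v + M}"

section \<open>Exceptional vertices of the search forest are rare\<close>

lemma finite_nbrs: "finite (nbrs E v)"
  by (rule finite_subset[OF nbrs_subset[OF simple] finite_V])

text \<open>An edge between incomparable vertices lies in \<open>N\<close>, so a vertex that is not
  full has at least \<open>e\<close> neighbours through \<open>N\<close>. Summing the degrees in
  \<open>N\<close> gives \<open>2 * card N\<close>.\<close>

lemma card_not_full: "e * card {v \<in> V. \<not> full v} \<le> 2 * card N"
proof -
  have sN: "simple_graph V N" using simple N_sub by (auto simp: simple_graph_def)
  have "N \<subseteq> Pow V" using sN by (auto simp: simple_graph_def)
  then have fN: "finite N" using finite_V by (simp add: finite_subset)
  have "e * card {v \<in> V. \<not> full v} = (\<Sum>v | v \<in> V \<and> \<not> full v. e)" by simp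
  also have "\<dots> \<le> (\<Sum>v | v \<in> V \<and> \<not> full v. card (nbrs N v))"
  proof (rule sum_mono)
    fix v assume v: "v \<in> {v \<in> V. \<not> full v}"
    have sub: "nbrs E v \<subseteq> {u \<in> nbrs E v. comparable u v} \<union> nbrs N v"
      using comparable_or_N by (auto simp: nbrs_def comparable_def insert_commute)
    have fin: "finite (nbrs N v)"
      by (rule finite_subset[OF nbrs_subset[OF sN] finite_V])
    have "k \<le> card (nbrs E v)" using v deg by simp
    also have "\<dots> \<le> card ({u \<in> nbrs E v. comparable u v} \<union> nbrs N v)"
      using sub fin finite_nbrs by (intro card_mono) auto
    also have "\<dots> \<le> card {u \<in> nbrs E v. comparable u v} + card (nbrs N v)" by (rule card_Un_le)
    finally show "e \<le> card (nbrs N v)" using v by (simp add: full_def)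
  qed
  also have "\<dots> \<le> (\<Sum>v\<in>V. card (nbrs N v))" using finite_V by (intro sum_mono2) auto
  also have "\<dots> = (\<Sum>v\<in>V. card {f \<in> N. v \<in> f})"
    using vertex_degree_eq_card_nbrs[OF sN] by (simp add: vertex_degree_def)
  also have "\<dots> = 2 * card N"
  proof (rule sum_multicount[OF finite_V fN], rule ballI)
    fix f assume "f \<in> N"
    then have "f \<subseteq> V" "card f = 2" using sN by (auto simp: simple_graph_def)
    moreover have "{v \<in> V. v \<in> f} = f" using \<open>f \<subseteq> V\<close> by blast
    ultimately show "card {v \<in> V. v \<in> f} = 2" by simp
  qed
  finally show ?thesis .
qed

text \<open>The common way to contradict \<open>kst\<close>. Since \<open>kst\<close> speaks of
  exactly \<open>b\<close> vertices, \<open>X\<close> is first trimmed to that size.\<close>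

lemma dense_contradiction:
  assumes "X \<subseteq> V" "b \<le> card X" "finite Y" "card Y \<le> m + 9 * w"
    and nb: "\<And>v. v \<in> X \<Longrightarrow> k - 3 * e \<le> card (nbrs E v \<inter> Y)"
  shows False
proof -
  obtain X' where X': "X' \<subseteq> X" "card X' = b" "finite X'"
    by (meson obtain_subset_with_card_n assms(2))
  have "(k - 3 * e)\<^sup>2 * card X' \<le> card Y * ((k - 3 * e) + card X')"
  proof (rule card_mult_le_of_intersections[where A = "\<lambda>v. nbrs E v \<inter> Y"])
    fix v v' :: 'a assume "v \<noteq> v'"
    have "card ((nbrs E v \<inter> Y) \<inter> (nbrs E v' \<inter> Y)) \<le> card (nbrs E v \<inter> nbrs E v')"
      using finite_nbrs by (intro card_mono) auto
    then show "card ((nbrs E v \<inter> Y) \<inter> (nbrs E v' \<inter> Y)) \<le> 1"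
      using C4_free_common_nbrs[OF finite_V simple C4 \<open>v \<noteq> v'\<close>] by linarith
  qed (use assms X' in auto)
  also have "\<dots> \<le> (m + 9 * w) * ((k - 3 * e) + card X')"
    using assms(4) by (rule mult_right_mono) simp
  finally show False using kst X'(2) by simp
qed

text \<open>A poor vertex found in the window has all its descendants found by time
  \<open>t + 3 * w\<close>. Up to that time the stacks agree except for at most \<open>3 * w\<close>
  vertices, so all neighbours along short forest edges lie in one set \<open>Y\<close> that is too
  small for \<open>b\<close> full vertices.\<close>

lemma card_poor_window:
  "card {v \<in> V. poor v \<and> full v \<and> t \<le> push v \<and> push v < t + w} < b" (is "card ?X < b")
proof (rule ccontr)
  assume "\<not> card ?X < b"
  then have bX: "b \<le> card ?X" by simp
  have "b > 0" using kst by (cases b) auto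
  then have "?X \<noteq> {}" using bX by (metis card.empty not_le)
  then have tT: "t \<le> T" using push_le_T by fastforce
  \<comment> \<open>The minimum stops the window at the end of the tour.\<close>
  define l where "l = min (3 * w) (T - t)"
  have "t + l \<le> T" using tT by (simp add: l_def)
  from window[OF this] obtain c S where S: "finite S" "card S \<le> l"
    and cS: "\<forall>\<tau>\<in>{t..t + l}. \<exists>r. st \<tau> = c @ r \<and> set r \<subseteq> S" by (elim exE conjE)
  \<comment> \<open>A short edge upwards climbs fewer than \<open>m\<close> levels, and all stems in
    question contain \<open>c\<close>; so an ancestor reached inside \<open>c\<close> is among its
    last \<open>m\<close> vertices.\<close>
  define Y where "Y = S \<union> set (drop (length c - m) c)"
  have "card Y \<le> card S + card (set (drop (length c - m) c))"
    unfolding Y_def by (rule card_Un_le)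
  also have "card (set (drop (length c - m) c)) \<le> length (drop (length c - m) c)"
    by (rule card_length)
  also have "length (drop (length c - m) c) \<le> m" by simp
  finally have cardY: "card Y \<le> m + 9 * w" using S by (simp add: l_def)
  have in_l: "push u \<in> {t..t + l}" if "u \<in> V" "t \<le> push u" "push u \<le> t + 3 * w" for u
    using that push_le_T[OF that(1)] by (auto simp: l_def)
  have len_c: "length c \<le> dep u" if "u \<in> V" "t \<le> push u" "push u \<le> t + 3 * w" for u
  proof -
    from bspec[OF cS in_l[OF that]] obtain r where "st (push u) = c @ r" by (elim exE conjE)
    then show ?thesis by (simp add: dep_def stem_def)
  qed
  have inY: "u \<in> Y" if "x \<in> V" "t \<le> push x" "push x \<le> t + 3 * w" "u \<in> set (stem x)" "length c < dep u + m" for u x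
  proof -
    from bspec[OF cS in_l[OF that(1-3)]] obtain r where r: "stem x = c @ r" "set r \<subseteq> S"
      unfolding stem_def by (elim exE conjE)
    show ?thesis
    proof (cases "dep u \<le> length c")
      case True
      have d: "0 < dep u" "stem x ! (dep u - 1) = u" using stem_ancestor(2-4)[OF that(1,4)] by auto
      have i: "dep u - 1 < length c" "length c - m \<le> dep u - 1" using True d(1) that(5) by auto
      moreover have "c ! (dep u - 1) = u" using d(2) i(1) by (simp add: r(1) nth_append)
      ultimately have "u \<in> set (drop (length c - m) c)" using nth_mem_set_drop by metis
      then show ?thesis by (simp add: Y_def)
    next
      case False
      have d: "dep u \<le> dep x" "stem x ! (dep u - 1) = u" using stem_ancestor(2-4)[OF that(1,4)] by auto
      have "\<not> dep u - 1 < length c" using False by simp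
      then have "r ! (dep u - 1 - length c) = u" using d(2) by (simp add: r(1) nth_append)
      moreover have "dep u - 1 - length c < length r"
        using False d(1) r(1) by (simp add: dep_def[of x])
      ultimately have "u \<in> set r" by (metis nth_mem)
      then show ?thesis using r by (auto simp: Y_def)
    qed
  qed
  show False
  proof (rule dense_contradiction[OF _ bX _ cardY])
    show "finite Y" using S by (simp add: Y_def)
    fix v assume v: "v \<in> ?X"
    let ?C = "{u \<in> nbrs E v. comparable u v}"
    let ?L = "{u \<in> nbrs E v. comparable u v \<and> (dep u + m \<le> dep v \<or> dep v + m \<le> dep u)}"
    have "?C - ?L \<subseteq> nbrs E v \<inter> Y"
    proof
      fix u assume u: "u \<in> ?C - ?L"
      then have uV: "u \<in> V" using nbrs_subset[OF simple] by blast
      from u consider "u \<in> set (stem v)" | "v \<in> set (stem u)" by (auto simp: comparable_def)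
      then have "u \<in> Y"
      proof cases
        case 1
        then show ?thesis using v u len_c[of v] by (intro inY[of v]) auto
      next
        case 2
        have "push u \<le> t + 3 * w" "t \<le> push u"
          using v uV 2 push_mono[OF 2] by (auto simp: poor_def)
        moreover from this have "length c \<le> dep u" using uV len_c by blast
        ultimately show ?thesis using uV mem_stem[OF uV] m_pos by (intro inY[of u]) auto
      qed
      then show "u \<in> nbrs E v \<inter> Y" using u by simp
    qed
    then have "card (?C - ?L) \<le> card (nbrs E v \<inter> Y)"
      using finite_nbrs by (intro card_mono) auto
    moreover have "card ?C - card ?L \<le> card (?C - ?L)"
      using finite_nbrs by (intro diff_card_le_card_Diff) auto
    moreover have "card ?L < e" using v few_long by simp
    moreover have "k \<le> card ?C + e" using v by (simp add: full_def)
    ultimately show "k - 3 * e \<le> card (nbrs E v \<inter> Y)" by linarith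
  qed auto
qed

text \<open>The tour lasts at most \<open>2 * card V\<close> steps; cut this time into windows of
  length \<open>w\<close>.\<close>

lemma card_poor_full: "card {v \<in> V. poor v \<and> full v} \<le> b * (2 * card V div w + 1)"
proof -
  let ?X = "\<lambda>j. {v \<in> V. poor v \<and> full v \<and> j * w \<le> push v \<and> push v < j * w + w}"
  have "{v \<in> V. poor v \<and> full v} \<subseteq> (\<Union>j\<le>2 * card V div w. ?X j)"
  proof
    fix v assume v: "v \<in> {v \<in> V. poor v \<and> full v}"
    then have "push v \<le> 2 * card V" using push_le_T[of v] T_le by simp
    then have "push v div w \<le> 2 * card V div w" by (rule div_le_mono)
    moreover have "v \<in> ?X (push v div w)"
      using v w_pos dividend_less_div_times[OF w_pos, of "push v"] by (simp add: add.commute)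
    ultimately show "v \<in> (\<Union>j\<le>2 * card V div w. ?X j)" by blast
  qed
  then have "card {v \<in> V. poor v \<and> full v} \<le> card (\<Union>j\<le>2 * card V div w. ?X j)"
    using finite_V by (intro card_mono) auto
  also have "\<dots> \<le> (\<Sum>j\<le>2 * card V div w. card (?X j))" by (rule card_UN_le) simp
  also have "\<dots> \<le> (\<Sum>j\<le>2 * card V div w. b)"
    using card_poor_window by (intro sum_mono) (simp add: less_imp_le)
  finally show ?thesis by (simp add: mult.commute)
qed

lemma card_poor:
  "card {v \<in> V. poor v} \<le> card {v \<in> V. \<not> full v} + b * (2 * card V div w + 1)"
proof -
  have "card {v \<in> V. poor v} \<le> card ({v \<in> V. \<not> full v} \<union> {v \<in> V. poor v \<and> full v})"
    using finite_V by (intro card_mono) auto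
  also have "\<dots> \<le> card {v \<in> V. \<not> full v} + card {v \<in> V. poor v \<and> full v}" by (rule card_Un_le)
  finally show ?thesis using card_poor_full by linarith
qed

text \<open>A rich vertex has at least \<open>w\<close> proper descendants. Those of a minimal rich
  vertex are all poor, and two minimal rich vertices share none.\<close>

lemma card_minimal_rich: "w * card {x \<in> V. minimal_rich x} \<le> card {v \<in> V. poor v}"
proof -
  let ?MR = "{x \<in> V. minimal_rich x}"
  define D where "D x = {u \<in> V. x \<in> set (stem u) \<and> u \<noteq> x}" for x
  have "w \<le> card (D x)" if x: "x \<in> ?MR" for x
  proof -
    from x have xV: "x \<in> V" and "\<not> poor x" by (auto simp: minimal_rich_def)
    then obtain u where u: "u \<in> V" "x \<in> set (stem u)" "push x + 2 * w < push u"
      unfolding poor_def by force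
    let ?B = "{v \<in> V. push x < push v \<and> push v \<le> push u}"
    \<comment> \<open>More than \<open>2 * w\<close> steps pass while the stack gets no shorter in
      total, so at least half of them are pushes.\<close>
    have "length (st (push u)) + (push u - push x) = length (st (push x)) + 2 * card ?B"
      using u(3) push_le_T[OF u(1)] by (intro card_pushed) auto
    moreover have "length (st (push x)) \<le> length (st (push u))"
      using stem_ancestor(3)[OF u(1,2)] by (simp add: dep_def stem_def)
    ultimately have "w \<le> card ?B" using u(3) by linarith
    moreover have "?B \<subseteq> D x"
    proof
      fix v assume v: "v \<in> ?B"
      have "x \<in> set (st (push v))"
      proof (rule persist)
        show "x \<in> set (st (push x))" by (rule mem_st_push[OF xV])
        show "x \<in> set (st (push u))" using u(2) by (simp add: stem_def)
        show "push x \<le> push v" "push v \<le> push u" using v by simp_all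
        show "push u \<le> T" by (rule push_le_T[OF u(1)])
      qed
      then have "x \<in> set (stem v)" by (simp add: stem_def)
      moreover have "v \<noteq> x" using v by auto
      ultimately show "v \<in> D x" using v by (simp add: D_def)
    qed
    ultimately show ?thesis using finite_V card_mono[of "D x" ?B] by (simp add: D_def)
  qed
  then have "w * card ?MR \<le> (\<Sum>x\<in>?MR. card (D x))"
    using sum_bounded_below[of ?MR w "\<lambda>x. card (D x)"] by (simp add: mult.commute)
  also have "\<dots> = card (\<Union>x\<in>?MR. D x)"
  proof (rule card_UN_disjoint[symmetric])
    show "\<forall>x\<in>?MR. \<forall>y\<in>?MR. x \<noteq> y \<longrightarrow> D x \<inter> D y = {}"
    proof (intro ballI impI, rule ccontr)
      fix x y assume xy: "x \<in> ?MR" "y \<in> ?MR" "x \<noteq> y" "D x \<inter> D y \<noteq> {}"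
      then obtain u where u: "u \<in> V" "x \<in> set (stem u)" "y \<in> set (stem u)" by (auto simp: D_def)
      \<comment> \<open>A common descendant makes \<open>x\<close> and \<open>y\<close> comparable,
        and then the upper one has a rich proper descendant.\<close>
      have "x \<in> set (stem y) \<or> y \<in> set (stem x)"
        using ancestor_linear[OF u] ancestor_linear[OF u(1,3,2)] by linarith
      then show False using xy by (auto simp: minimal_rich_def)
    qed
  qed (use finite_V in \<open>auto simp: D_def\<close>)
  also have "\<dots> \<le> card {v \<in> V. poor v}"
    using finite_V by (intro card_mono) (auto simp: D_def minimal_rich_def)
  finally show ?thesis .
qed

text \<open>Below a low vertex that is rich there is a minimal rich vertex, fewer than
  \<open>M\<close> levels down. So the low vertex is among the last \<open>M\<close> entries of that
  vertex's stem.\<close>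

lemma card_low: "card {v \<in> V. low v} \<le> card {v \<in> V. poor v} + M * card {x \<in> V. minimal_rich x}"
proof -
  let ?MR = "{x \<in> V. minimal_rich x}"
  have "{v \<in> V. low v} \<subseteq> {v \<in> V. poor v} \<union> (\<Union>x\<in>?MR. set (drop (dep x - M) (stem x)))"
  proof
    fix v assume "v \<in> {v \<in> V. low v}"
    then have v: "v \<in> V" "low v" by auto
    show "v \<in> {v \<in> V. poor v} \<union> (\<Union>x\<in>?MR. set (drop (dep x - M) (stem x)))"
    proof (cases "poor v")
      case False
      define R where "R = {x \<in> V. v \<in> set (stem x) \<and> \<not> poor x}"
      have "v \<in> R" "finite R" using v False mem_stem finite_V by (auto simp: R_def)
      \<comment> \<open>A deepest rich vertex below \<open>v\<close> is minimal rich.\<close>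
      have "\<exists>x\<in>R. dep x = Max (dep ` R)"
        using Max_in[of "dep ` R"] \<open>v \<in> R\<close> \<open>finite R\<close> by fastforce
      then obtain x where x: "x \<in> R" "\<And>y. y \<in> R \<Longrightarrow> dep y \<le> dep x"
        using \<open>finite R\<close> by (metis Max_ge finite_imageI imageI)
      then have xV: "x \<in> V" and vx: "v \<in> set (stem x)" and "\<not> poor x" by (auto simp: R_def)
      have "poor u" if "u \<in> V" "x \<in> set (stem u)" "u \<noteq> x" for u
      proof (rule ccontr)
        assume "\<not> poor u"
        then have "u \<in> R" using that vx ancestor_trans by (auto simp: R_def)
        then have "dep u \<le> dep x" by (rule x(2))
        then show False using ancestor_dep_less[of u x] that by simp
      qed
      then have "x \<in> ?MR" using xV \<open>\<not> poor x\<close> by (simp add: minimal_rich_def)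
      moreover have "dep x < dep v + M"
      proof (rule ccontr)
        assume a: "\<not> ?thesis"
        have p: "0 < dep v" using dep_pos v by simp
        \<comment> \<open>The vertex of \<open>stem x\<close> that is exactly \<open>M\<close>
          levels below \<open>v\<close>; its existence would contradict that \<open>v\<close> is
          low.\<close>
        let ?u = "stem x ! (dep v + M - 1)"
        have i: "dep v + M - 1 < dep x" using a p by simp
        have "dep ?u = dep v + M" using dep_stem_nth[OF xV i] p by simp
        moreover have ux: "?u \<in> set (stem x)" using i by (simp add: dep_def)
        moreover have "v \<in> set (stem ?u)"
          using calculation by (intro ancestor_linear[OF xV ux vx]) simp
        moreover have "?u \<in> V" using ux set_stem[OF xV] by blast
        ultimately show False using v by (auto simp: low_def)
      qed
      moreover have "v \<in> set (drop (dep x - M) (stem x))"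
      proof -
        have d: "0 < dep v" "dep v \<le> dep x" "stem x ! (dep v - 1) = v" using stem_ancestor(2-4)[OF xV vx] by auto
        have "dep x - M \<le> dep v - 1" "dep v - 1 < dep x" using d \<open>dep x < dep v + M\<close> by auto
        then show ?thesis using nth_mem_set_drop[of "dep x - M" "dep v - 1" "stem x"] d by (simp add: dep_def)
      qed
      ultimately show ?thesis by blast
    qed (use v in simp)
  qed
  then have "card {v \<in> V. low v} \<le> card ({v \<in> V. poor v} \<union> (\<Union>x\<in>?MR. set (drop (dep x - M) (stem x))))"
    using finite_V by (intro card_mono) auto
  also have "\<dots> \<le> card {v \<in> V. poor v} + card (\<Union>x\<in>?MR. set (drop (dep x - M) (stem x)))"
    by (rule card_Un_le)
  also have "card (\<Union>x\<in>?MR. set (drop (dep x - M) (stem x))) \<le> (\<Sum>x\<in>?MR. card (set (drop (dep x - M) (stem x))))"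
    using finite_V by (intro card_UN_le) auto
  also have "\<dots> \<le> (\<Sum>x\<in>?MR. M)"
  proof (rule sum_mono)
    fix x
    show "card (set (drop (dep x - M) (stem x))) \<le> M"
      using card_length[of "drop (dep x - M) (stem x)"] by (simp add: dep_def)
  qed
  finally show ?thesis by (simp add: mult.commute)
qed

section \<open>A long path with little hanging off it\<close>

text \<open>Counted from the other end: a vertex \<open>u\<close> lies in \<open>below v\<close>
  only if \<open>v\<close> is one of the last \<open>M + 1\<close> vertices of
  \<open>stem u\<close>.\<close>

lemma sum_card_below:
  assumes "S \<subseteq> V" shows "(\<Sum>v\<in>V. card (below v \<inter> S)) \<le> (M + 1) * card S"
proof -
  have fS: "finite S" using assms finite_V by (rule finite_subset)
  have "(\<Sum>v\<in>V. card (below v \<inter> S)) = (\<Sum>v\<in>V. card {u \<in> S. u \<in> below v})"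
    by (intro sum.cong refl arg_cong[where f = card]) auto
  also have "\<dots> = (\<Sum>u\<in>S. card {v \<in> V. u \<in> below v})"
    using finite_V fS by (rule sum_multicount_gen) simp
  also have "\<dots> \<le> (\<Sum>u\<in>S. M + 1)"
  proof (rule sum_mono)
    fix u assume "u \<in> S"
    then have uV: "u \<in> V" using assms by blast
    have "{v \<in> V. u \<in> below v} \<subseteq> set (drop (dep u - (M + 1)) (stem u))"
    proof
      fix v assume "v \<in> {v \<in> V. u \<in> below v}"
      then have v: "v \<in> set (stem u)" "dep u \<le> dep v + M" by (auto simp: below_def)
      have d: "0 < dep v" "dep v \<le> dep u" "stem u ! (dep v - 1) = v" using stem_ancestor(2-4)[OF uV v(1)] by auto
      have "dep u - (M + 1) \<le> dep v - 1" "dep v - 1 < dep u" using d v(2) by auto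
      then show "v \<in> set (drop (dep u - (M + 1)) (stem u))"
        using nth_mem_set_drop[of "dep u - (M + 1)" "dep v - 1" "stem u"] d(3) by (simp add: dep_def)
    qed
    then have "card {v \<in> V. u \<in> below v} \<le> card (set (drop (dep u - (M + 1)) (stem u)))"
      by (intro card_mono) auto
    also have "\<dots> \<le> length (drop (dep u - (M + 1)) (stem u))" by (rule card_length)
    also have "\<dots> \<le> M + 1" by (simp add: dep_def)
    finally show "card {v \<in> V. u \<in> below v} \<le> M + 1" .
  qed
  finally show ?thesis by (simp add: mult.commute)
qed

text \<open>Averaging over the vertices that are not low. The path from \<open>v\<close> to
  \<open>u\<close> already has \<open>M + 1\<close> vertices, so the bound leaves at most
  \<open>w\<close> vertices of \<open>below v\<close> off the path and at most \<open>w / 2\<close>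
  that are not full; the weight 2 is there for the latter.\<close>

lemma ex_light:
  assumes "card {v \<in> V. low v} * (M + 1 + w) + 2 * (M + 1) * card {v \<in> V. \<not> full v} < w * card V"
  obtains v u where "v \<in> V" "u \<in> V" "v \<in> set (stem u)" "dep u = dep v + M"
    "card (below v) + 2 * card (below v \<inter> {v \<in> V. \<not> full v}) \<le> M + 1 + w"
proof -
  let ?NF = "{v \<in> V. \<not> full v}" and ?L = "{v \<in> V. low v}"
  let ?f = "\<lambda>v. card (below v) + 2 * card (below v \<inter> ?NF)"
  have "\<exists>v\<in>V - ?L. ?f v \<le> M + 1 + w"
  proof (rule ccontr)
    assume "\<not> ?thesis"
    then have big: "M + 1 + w \<le> ?f v" if "v \<in> V - ?L" for v using that by force
    have "(card V - card ?L) * (M + 1 + w) = (\<Sum>v\<in>V - ?L. M + 1 + w)"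
      using finite_V by (simp add: card_Diff_subset)
    also have "\<dots> \<le> (\<Sum>v\<in>V - ?L. ?f v)" using big by (rule sum_mono)
    also have "\<dots> \<le> (\<Sum>v\<in>V. ?f v)" using finite_V by (intro sum_mono2) auto
    also have "\<dots> = (\<Sum>v\<in>V. card (below v \<inter> V)) + 2 * (\<Sum>v\<in>V. card (below v \<inter> ?NF))"
    proof -
      have "below v \<inter> V = below v" for v by (auto simp: below_def)
      then show ?thesis by (simp add: sum.distrib sum_distrib_left)
    qed
    also have "\<dots> \<le> (M + 1) * card V + 2 * ((M + 1) * card ?NF)"
      by (intro add_mono mult_left_mono sum_card_below) auto
    finally have "(card V - card ?L) * (M + 1 + w) \<le> (M + 1) * card V + 2 * (M + 1) * card ?NF" by simp
    moreover have "card V * (M + 1 + w) = (card V - card ?L) * (M + 1 + w) + card ?L * (M + 1 + w)"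
      using card_mono[of V ?L] finite_V by (simp add: add_mult_distrib[symmetric])
    ultimately have "card V * (M + 1 + w) \<le> (M + 1) * card V + 2 * (M + 1) * card ?NF + card ?L * (M + 1 + w)"
      by linarith
    moreover have "card V * (M + 1 + w) = (M + 1) * card V + w * card V" by (simp add: algebra_simps)
    ultimately show False using assms by linarith
  qed
  then show ?thesis using that by (auto simp: low_def)
qed

text \<open>Otherwise each full vertex of the segment loses fewer than \<open>e\<close> neighbours
  upwards, fewer than \<open>e\<close> through long edges and at most \<open>e\<close> to
  incomparability. The other \<open>k - 3 * e\<close> lie on the path near the segment or among the
  few vertices off the path, and \<open>kst\<close> is violated.\<close>

lemma good_vertex_in_window:
  assumes v: "v \<in> V" and z: "z \<in> V" and vz: "v \<in> set (stem z)" and dz: "dep z = dep v + M"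
    and light: "card (below v) + 2 * card (below v \<inter> {v \<in> V. \<not> full v}) \<le> M + 1 + w"
    and j: "(j + 1) * w + m \<le> M"
  shows "\<exists>g. dep v - 1 + j * w \<le> g \<and> g < dep v - 1 + (j + 1) * w \<and>
    e \<le> card {i. i + 6 * w \<le> g \<and> {stem z ! i, stem z ! g} \<in> E}"
proof (rule ccontr)
  define Z where "Z = stem z"
  \<comment> \<open>The index of \<open>v\<close> on the path, as depths start at 1.\<close>
  define p0 where "p0 = dep v - 1"
  define lo where "lo = p0 + j * w"
  assume neg: "\<not> ?thesis"
  have few_up: "card {i. i + 6 * w \<le> g \<and> {Z ! i, Z ! g} \<in> E} < e" if "lo \<le> g" "g < lo + w" for g
  proof -
    have "dep v - 1 + j * w \<le> g" "g < dep v - 1 + (j + 1) * w"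
      using that by (auto simp: lo_def p0_def)
    then show ?thesis using neg unfolding Z_def by (meson not_le)
  qed
  have vpos: "0 < dep v" using dep_pos v by simp
  have lenZ: "length Z = p0 + M + 1" using dz vpos by (simp add: Z_def p0_def dep_def)
  have dZ: "distinct Z" using distinct_stem z by (simp add: Z_def)
  have depZ: "dep (Z ! i) = Suc i" if "i < length Z" for i
    using dep_stem_nth[OF z] that by (simp add: Z_def dep_def)
  have ZV: "Z ! i \<in> V" if "i < length Z" for i
    using subsetD[OF set_stem[OF z] nth_mem] that by (simp add: Z_def)
  have ZZ: "Z ! i \<in> set (stem (Z ! i'))" if "i \<le> i'" "i' < length Z" for i i'
  proof (rule ancestor_linear[OF z])
    show "Z ! i' \<in> set (stem z)" "Z ! i \<in> set (stem z)" using that by (simp_all add: Z_def)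
    show "dep (Z ! i) \<le> dep (Z ! i')" using that depZ by simp
  qed
  have vZ: "Z ! p0 = v" using stem_ancestor(4)[OF z vz] by (simp add: Z_def p0_def)
  define P where "P = (!) Z ` {p0..<p0 + M + 1}"
  have injZ: "inj_on ((!) Z) I" if "I \<subseteq> {..<length Z}" for I
    using dZ that by (intro inj_on_nth) auto
  have cP: "card P = M + 1" unfolding P_def using lenZ by (subst card_image) (auto intro!: injZ)
  have Pb: "P \<subseteq> below v"
    using ZV ZZ[of p0] depZ vpos lenZ unfolding P_def below_def vZ by (auto simp: p0_def)
  have fb: "finite (below v)" using finite_V by (simp add: below_def)
  \<comment> \<open>The path from \<open>6 * w\<close> before the segment to \<open>m\<close> after
    it, at most \<open>7 * w + m\<close> vertices even if truncated at the root, and the at most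
    \<open>w\<close> vertices that hang off the path.\<close>
  define Y where "Y = (!) Z ` {lo - 6 * w..<lo + w + m} \<union> (below v - P)"
  have "card (below v - P) = card (below v) - (M + 1)"
    using Pb fb cP by (simp add: card_Diff_subset finite_subset)
  then have "card (below v - P) \<le> w" using light by linarith
  moreover have "card ((!) Z ` {lo - 6 * w..<lo + w + m}) \<le> 7 * w + m"
    using card_image_le[of "{lo - 6 * w..<lo + w + m}" "(!) Z"] by simp
  ultimately have cY: "card Y \<le> m + 9 * w"
    unfolding Y_def using card_Un_le[of "(!) Z ` {lo - 6 * w..<lo + w + m}" "below v - P"] by linarith
  define W where "W = (!) Z ` {lo..<lo + w}"
  have low_len: "lo + w + m \<le> p0 + M" using j by (simp add: lo_def)
  have cW: "card W = w" unfolding W_def using lenZ low_len by (subst card_image) (auto intro!: injZ)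
  have WP: "W \<subseteq> P" using low_len by (auto simp: W_def P_def lo_def)
  let ?NF = "{v \<in> V. \<not> full v}"
  have "card (W \<inter> ?NF) \<le> card (below v \<inter> ?NF)"
    using WP Pb fb by (intro card_mono) auto
  moreover have "M + 1 \<le> card (below v)" using card_mono[OF fb Pb] cP by simp
  \<comment> \<open>At least half of the segment is full, which yields \<open>b\<close> vertices
    because \<open>2 * b \<le> w\<close>.\<close>
  ultimately have "2 * card (W \<inter> ?NF) \<le> w" using light by linarith
  moreover have "card (W - ?NF) = w - card (W \<inter> ?NF)"
    using cW by (simp add: card_Diff_subset_Int W_def)
  ultimately have bX: "b \<le> card (W - ?NF)" using b_le by linarith
  show False
  proof (rule dense_contradiction[OF _ bX _ cY])
    show "W - ?NF \<subseteq> V" using WP Pb by (auto simp: below_def)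
    show "finite Y" using fb by (simp add: Y_def)
    fix x assume x: "x \<in> W - ?NF"
    then obtain g where g: "x = Z ! g" "lo \<le> g" "g < lo + w" by (auto simp: W_def)
    have gl: "g < length Z" using g low_len lenZ by simp
    have xV: "x \<in> V" and dx: "dep x = Suc g" using ZV depZ gl g by auto
    have vx: "v \<in> set (stem x)" using ZZ[of p0 g] g gl vZ by (simp add: lo_def)
    have xZ: "x \<in> set (stem z)" using g gl by (simp add: Z_def)
    have "full x" using x xV by auto
    let ?C = "{u \<in> nbrs E x. comparable u x}"
    let ?L = "{u \<in> nbrs E x. comparable u x \<and> (dep u + m \<le> dep x \<or> dep x + m \<le> dep u)}"
    let ?U = "{u \<in> nbrs E x. u \<in> set (stem x) \<and> dep u + 6 * w \<le> dep x}"
    have nthu: "Z ! (dep u - 1) = u" if "u \<in> set (stem x)" for u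
      using stem_ancestor(4)[OF z ancestor_trans[OF z xZ that]] by (simp add: Z_def)
    have "?C - (?L \<union> ?U) \<subseteq> nbrs E x \<inter> Y"
    proof
      fix u assume u: "u \<in> ?C - (?L \<union> ?U)"
      then have uV: "u \<in> V" using nbrs_subset[OF simple] by blast
      from u consider "u \<in> set (stem x)" | "x \<in> set (stem u)" by (auto simp: comparable_def)
      then have "u \<in> Y"
      proof cases
        case 1
        then have "dep x < dep u + 6 * w" using u by auto
        moreover have "0 < dep u" "dep u \<le> dep x" using stem_ancestor(2-4)[OF xV 1] by auto
        ultimately have "dep u - 1 \<in> {lo - 6 * w..<lo + w + m}" using g dx by auto
        then have "Z ! (dep u - 1) \<in> Y" unfolding Y_def by blast
        then show ?thesis using nthu[OF 1] by simp
      next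
        case 2
        then have du: "dep u < dep x + m" "dep x \<le> dep u" using u stem_ancestor(3)[OF uV 2] by auto
        have "v \<in> set (stem u)" using ancestor_trans[OF uV 2 vx] .
        \<comment> \<open>At least \<open>m\<close> levels remain between the segment and the end of
          the path, so a short edge downwards stays inside \<open>below v\<close>.\<close>
        moreover have "dep u \<le> dep v + M" using du dx g low_len by (simp add: p0_def)
        ultimately have "u \<in> below v" using uV by (simp add: below_def)
        show ?thesis
        proof (cases "u \<in> P")
          case True
          then obtain i where i: "u = Z ! i" "i < length Z" using lenZ by (auto simp: P_def)
          then have "i \<in> {lo - 6 * w..<lo + w + m}" using du dx g depZ[of i] by auto
          then show ?thesis using i by (auto simp: Y_def)
        qed (use \<open>u \<in> below v\<close> in \<open>simp add: Y_def\<close>)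
      qed
      then show "u \<in> nbrs E x \<inter> Y" using u by simp
    qed
    then have "card (?C - (?L \<union> ?U)) \<le> card (nbrs E x \<inter> Y)"
      using finite_nbrs by (intro card_mono) auto
    moreover have "card ?C - card (?L \<union> ?U) \<le> card (?C - (?L \<union> ?U))"
      using finite_nbrs by (intro diff_card_le_card_Diff) auto
    moreover have "card (?L \<union> ?U) \<le> card ?L + card ?U" by (rule card_Un_le)
    moreover have "card ?L < e" using xV few_long by simp
    moreover have "card ?U < e"
    proof -
      let ?I = "{i. i + 6 * w \<le> g \<and> {Z ! i, Z ! g} \<in> E}"
      have "?I \<subseteq> {..g}" by auto
      then have fI: "finite ?I" by (rule finite_subset) simp
      have "?U \<subseteq> (!) Z ` ?I"
      proof
        fix u assume u: "u \<in> ?U"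
        have "0 < dep u" using stem_ancestor(2-4)[OF xV, of u] u by auto
        then have "dep u - 1 + 6 * w \<le> g" using u dx by auto
        moreover have "{Z ! (dep u - 1), Z ! g} \<in> E"
          using u nthu[of u] g by (simp add: nbrs_def insert_commute)
        ultimately have "Z ! (dep u - 1) \<in> (!) Z ` ?I" by blast
        then show "u \<in> (!) Z ` ?I" using nthu[of u] u by simp
      qed
      then have "card ?U \<le> card ?I" using fI by (meson card_image_le card_mono finite_imageI le_trans)
      then show ?thesis using few_up[OF g(2,3)] by linarith
    qed
    moreover have "k \<le> card ?C + e" using \<open>full x\<close> by (simp add: full_def)
    ultimately show "k - 3 * e \<le> card (nbrs E x \<inter> Y)" by linarith
  qed
qed

end

section \<open>A cycle from overlapping chords\<close>

lemma successively_map_upt: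
  assumes "successively R Z" "b \<le> length Z"
  shows "successively R (map ((!) Z) [a..<b])"
  using assms by (simp add: successively_conv_nth)

text \<open>Induction on \<open>x\<close>, towards the root. The path \<open>L\<close> has ends
  \<open>Z ! x\<close> and \<open>Z ! y\<close>, and apart from \<open>Z ! x\<close> it uses only
  indices from \<open>y\<close> on, so the stretch of \<open>Z\<close> between \<open>x\<close> and
  \<open>y\<close> is free. If \<open>x\<close> lies before the first block, that stretch closes a
  cycle. Otherwise a chord from \<open>g\<close> just after \<open>x\<close> to some
  \<open>t\<close> before \<open>x\<close> extends the path, and the pair \<open>(t, x)\<close>
  takes over the role of \<open>(x, y)\<close>. The index \<open>a0\<close> is kept to measure how
  much of \<open>Z\<close> is covered.\<close>

lemma zigzag_extend:
  fixes Z :: "'a list" and F :: "'a set set" and w p0 J a0 :: nat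
  assumes dZ: "distinct Z" and sZ: "successively (\<lambda>a b. {a, b} \<in> F) Z"
    and w: "0 < w" and len: "p0 + J * w \<le> length Z"
    and chord: "\<And>j. j < J \<Longrightarrow> \<exists>g t. p0 + j * w \<le> g \<and> g < p0 + (j + 1) * w \<and> t + 6 * w \<le> g \<and> {Z ! t, Z ! g} \<in> F"
    and a0: "a0 < p0 + J * w"
  shows "\<lbrakk>L \<noteq> []; hd L = Z ! x; last L = Z ! y; distinct L; successively (\<lambda>a b. {a, b} \<in> F) L;
     set L \<subseteq> insert (Z ! x) ((!) Z ` {y..<length Z}); x + 4 * w \<le> y; y \<le> a0; a0 \<le> y + 2 * length L\<rbrakk>
    \<Longrightarrow> \<exists>xs. is_cycle F xs \<and> a0 \<le> p0 + 2 * length xs"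
proof (induction x arbitrary: y L rule: less_induct)
  case (less x)
  note L = less.prems
  have ylen: "y < length Z" using L(8) a0 len by linarith
  have Zinj: "Z ! i = Z ! j \<longleftrightarrow> i = j" if "i < length Z" "j < length Z" for i j
    using dZ that by (rule nth_eq_iff_index_eq)
  have notL: "Z ! i \<notin> set L" if "i < y" "i \<noteq> x" for i
  proof
    assume "Z ! i \<in> set L"
    then obtain i' where "i' = x \<or> y \<le> i'" "i' < length Z" "Z ! i = Z ! i'"
      using L(6,7) ylen by (force simp: subset_iff)
    then show False using that Zinj[of i i'] ylen by auto
  qed
  have edge: "{Z ! i, Z ! Suc i} \<in> F" if "Suc i < length Z" for i
    using sZ that by (simp add: successively_conv_nth)
  have "0 < y" using L(7) w by linarith
  then have yedge: "{Z ! (y - 1), Z ! y} \<in> F" using edge[of "y - 1"] ylen by simp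
  show ?case
  proof (cases "x < p0")
    case True
    \<comment> \<open>Walk back along \<open>Z\<close> from \<open>y\<close> to
      \<open>x\<close>.\<close>
    let ?D = "rev (map ((!) Z) [Suc x..<y])"
    let ?xs = "L @ ?D"
    have xy: "Suc x < y" using L(7) w by linarith
    have hdD: "hd ?D = Z ! (y - 1)" using xy by (simp add: hd_rev last_map)
    have lastD: "last ?D = Z ! Suc x" using xy by (simp add: last_rev hd_map)
    have ne: "?D \<noteq> []" using xy by simp
    have "is_cycle F ?xs"
    proof (rule is_cycleI)
      show "3 \<le> length ?xs" using L(1,7) w by (cases L) auto
      have "distinct (map ((!) Z) [Suc x..<y])"
        using Zinj ylen by (auto simp: distinct_map inj_on_def)
      then show "distinct ?xs" using L(4) notL by auto
      have "successively (\<lambda>a b. {a, b} \<in> F) ?D"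
        using successively_map_upt[OF sZ, of y "Suc x"] ylen by (simp add: insert_commute)
      moreover have "{last L, hd ?D} \<in> F" using yedge L(3) by (simp only: hdD) (simp add: insert_commute)
      ultimately show "successively (\<lambda>a b. {a, b} \<in> F) ?xs"
        using L(5) by (simp add: successively_append_iff)
      have "{Z ! x, Z ! Suc x} \<in> F" using edge[of x] xy ylen by simp
      then show "{last ?xs, hd ?xs} \<in> F"
        using L(1,2) lastD ne by (simp only: last_append hd_append if_False) (simp add: insert_commute)
    qed
    moreover have "a0 \<le> p0 + 2 * length ?xs" using True L(7,9) w by simp
    ultimately show ?thesis by blast
  next
    case False
    \<comment> \<open>The block after the one that contains \<open>x\<close>: its chord starts at a
      \<open>g\<close> with \<open>x < g < x + 2 * w\<close>.\<close>
    define j where "j = (x - p0) div w + 1"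
    have j0: "(x - p0) div w * w \<le> x - p0" "x - p0 < (x - p0) div w * w + w"
      using w dividend_less_div_times[OF w, of "x - p0"] by (auto simp: add.commute)
    have jw: "j * w = (x - p0) div w * w + w" by (simp add: j_def)
    have "j * w < J * w" using jw j0 L(7,8) a0 False by linarith
    then have "j < J" by simp
    from chord[OF this] obtain g t where g: "p0 + j * w \<le> g" "g < p0 + (j + 1) * w" "t + 6 * w \<le> g"
      and tg: "{Z ! t, Z ! g} \<in> F" by (elim exE conjE)
    have g2: "g < p0 + j * w + w" using g(2) by simp
    have xg: "x < g" "g < x + 2 * w" using g(1) g2 jw j0 False by linarith+
    have gy: "g + 2 * w \<le> y" using xg L(7) by linarith
    have tx: "t + 4 * w \<le> x" using xg(2) g(3) by linarith
    let ?G = "map ((!) Z) [g..<y]"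
    \<comment> \<open>Take the chord from \<open>t\<close> to \<open>g\<close>, follow
      \<open>Z\<close> up to \<open>y\<close>, then traverse \<open>L\<close> backwards to
      \<open>x\<close>. Only the indices strictly between \<open>x\<close> and \<open>g\<close> are
      skipped.\<close>
    let ?L = "Z ! t # ?G @ rev L"
    have Gne: "?G \<noteq> []" "hd ?G = Z ! g" "last ?G = Z ! (y - 1)"
      using gy w by (simp_all add: hd_map last_map)
    have set_G: "set ?G = (!) Z ` {g..<y}" by simp
    have tL: "Z ! t \<notin> set L" using notL[of t] tx w L(7) by auto
    have tG: "Z ! t \<notin> set ?G"
    proof
      assume "Z ! t \<in> set ?G"
      then obtain i where "g \<le> i" "i < y" "Z ! t = Z ! i" by auto
      then show False using Zinj[of t i] ylen tx xg(1) by simp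
    qed
    show ?thesis
    proof (rule less.IH[of t ?L x])
      show "t < x" using tx w by linarith
      show "?L \<noteq> []" "hd ?L = Z ! t" by simp_all
      show "last ?L = Z ! x" using L(1,2) by (simp add: last_rev)
      have "distinct ?G" using Zinj ylen by (auto simp: distinct_map inj_on_def)
      moreover have "set ?G \<inter> set L = {}" using notL xg(1) by auto
      ultimately show "distinct ?L" using tL tG L(4) by auto
      have "successively (\<lambda>a b. {a, b} \<in> F) ?G"
        using successively_map_upt[OF sZ, of y g] ylen by simp
      moreover have "successively (\<lambda>a b. {a, b} \<in> F) (rev L)" using L(5) by (simp add: insert_commute)
      moreover have "{last ?G, hd (rev L)} \<in> F" using yedge L(1,3) Gne(3) by (simp only: hd_rev)
      ultimately have "successively (\<lambda>a b. {a, b} \<in> F) (?G @ rev L)"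
        by (simp only: successively_append_iff) simp
      moreover have "hd (?G @ rev L) = Z ! g" using Gne by simp
      ultimately show "successively (\<lambda>a b. {a, b} \<in> F) ?L"
        using tg by (cases "?G @ rev L") auto
      have "set L \<subseteq> insert (Z ! t) ((!) Z ` {x..<length Z})"
        using L(6,7) ylen by (auto simp: subset_iff)
      moreover have "set ?G \<subseteq> (!) Z ` {x..<length Z}"
        using xg(1) ylen by auto
      ultimately show "set ?L \<subseteq> insert (Z ! t) ((!) Z ` {x..<length Z})" by auto
      show "t + 4 * w \<le> x" by (rule tx)
      show "x \<le> a0" using L(7,8) by linarith
      \<comment> \<open>Fewer than \<open>2 * w\<close> of the at least \<open>4 * w\<close> indices
        between \<open>x\<close> and \<open>y\<close> are skipped, so the factor 2 pays for
        them.\<close>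
      show "a0 \<le> x + 2 * length ?L" using L(7,9) xg gy by simp
    qed
  qed
qed

text \<open>Consecutive chords overlap in fewer than \<open>2 * w\<close> vertices of \<open>Z\<close>, and the cycle that alternates
  between chords and segments of \<open>Z\<close> misses only these overlaps.\<close>

lemma zigzag_cycle:
  fixes Z :: "'a list" and F :: "'a set set" and w p0 J :: nat
  assumes "distinct Z" "successively (\<lambda>a b. {a, b} \<in> F) Z"
    and w: "0 < w" and len: "p0 + J * w \<le> length Z" and "0 < J"
    and chord: "\<And>j. j < J \<Longrightarrow> \<exists>g t. p0 + j * w \<le> g \<and> g < p0 + (j + 1) * w \<and> t + 6 * w \<le> g \<and> {Z ! t, Z ! g} \<in> F"
  shows "\<exists>xs. is_cycle F xs \<and> (J - 1) * w \<le> 2 * length xs"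
proof -
  have J: "J - 1 + 1 = J" using \<open>0 < J\<close> by simp
  from chord[of "J - 1"] obtain g t where g: "p0 + (J - 1) * w \<le> g" "g < p0 + J * w" "t + 6 * w \<le> g"
    and tg: "{Z ! t, Z ! g} \<in> F" using \<open>0 < J\<close> unfolding J by auto
  have "\<exists>xs. is_cycle F xs \<and> g \<le> p0 + 2 * length xs"
  \<comment> \<open>The start is the chord of the last block, as a path with two vertices.\<close>
  proof (rule zigzag_extend[OF assms(1,2) w len chord g(2), of "[Z ! t, Z ! g]" t g])
    show "distinct [Z ! t, Z ! g]" using assms(1) g len w by (simp add: nth_eq_iff_index_eq)
    show "set [Z ! t, Z ! g] \<subseteq> insert (Z ! t) ((!) Z ` {g..<length Z})" using g(2) len by simp
  qed (use g tg in auto)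
  then show ?thesis using g(1) by (auto intro: order_trans dest: diff_le_mono)
qed

section \<open>Depth-first search\<close>

definition visited :: "'a list list \<Rightarrow> 'a set" where
  "visited H = \<Union> (set ` set H)"

fun stack_trace :: "'a list list \<Rightarrow> bool" where
  "stack_trace [] \<longleftrightarrow> False"
| "stack_trace [s] \<longleftrightarrow> s = []"
| "stack_trace (s # s' # H) \<longleftrightarrow>
    ((\<exists>v. v \<notin> visited (s' # H) \<and> s = s' @ [v]) \<or> (s' \<noteq> [] \<and> s = butlast s')) \<and> stack_trace (s' # H)"

text \<open>A state of depth-first search is the history of its stack, latest first, together with the set of
  edges that have been queried and found missing. The stacks have the root first.\<close>

definition dfs_step ::
  "'a set \<Rightarrow> 'a set set \<Rightarrow> 'a set set \<Rightarrow> 'a list list \<times> 'a set set \<Rightarrow> 'a list list \<times> 'a set set" where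
  "dfs_step V E F s =
    (let H = fst s; N = snd s; cur = hd H; R = V - visited H; C = {u \<in> R. {last cur, u} \<in> E - N}
     in if cur = [] then (if R = {} then s else ([SOME v. v \<in> R] # H, N))
        else if C = {} then (butlast cur # H, N)
        else if {last cur, SOME u. u \<in> C} \<in> F then ((cur @ [SOME u. u \<in> C]) # H, N)
        else (H, insert {last cur, SOME u. u \<in> C} N))"

text \<open>The case, and the edge queried in the case \<open>ask\<close>, depend on the state only;
  \<open>F\<close> enters through the answer alone. This lets the random edges be revealed one query
  at a time.\<close>

lemma dfs_step_cases:
  obtains
    (final) "hd (fst s) = []" "V \<subseteq> visited (fst s)" "\<And>F. dfs_step V E F s = s"
  | (root) v where "hd (fst s) = []" "v \<in> V - visited (fst s)" "\<And>F. dfs_step V E F s = ([v] # fst s, snd s)"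
  | (pop) "hd (fst s) \<noteq> []" "\<And>u. u \<in> V - visited (fst s) \<Longrightarrow> {last (hd (fst s)), u} \<in> E \<Longrightarrow> {last (hd (fst s)), u} \<in> snd s"
      "\<And>F. dfs_step V E F s = (butlast (hd (fst s)) # fst s, snd s)"
  | (ask) u where "hd (fst s) \<noteq> []" "u \<in> V - visited (fst s)" "{last (hd (fst s)), u} \<in> E - snd s"
      "\<And>F. dfs_step V E F s = (if {last (hd (fst s)), u} \<in> F then ((hd (fst s) @ [u]) # fst s, snd s)
         else (fst s, insert {last (hd (fst s)), u} (snd s)))"
proof -
  let ?R = "V - visited (fst s)" and ?C = "{u \<in> V - visited (fst s). {last (hd (fst s)), u} \<in> E - snd s}"
  consider "hd (fst s) = []" "?R = {}" | "hd (fst s) = []" "?R \<noteq> {}"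
    | "hd (fst s) \<noteq> []" "?C = {}" | "hd (fst s) \<noteq> []" "?C \<noteq> {}" by blast
  then show thesis
  proof cases
    case 1
    then have "dfs_step V E F s = s" for F by (simp add: dfs_step_def Let_def)
    then show ?thesis using 1 by (intro final) auto
  next
    case 2
    then have "(SOME v. v \<in> ?R) \<in> ?R" by (meson ex_in_conv someI_ex)
    moreover have "dfs_step V E F s = ([SOME v. v \<in> ?R] # fst s, snd s)" for F
      using 2 by (simp add: dfs_step_def Let_def)
    ultimately show ?thesis using 2 by (intro root)
  next
    case 3
    then have "dfs_step V E F s = (butlast (hd (fst s)) # fst s, snd s)" for F
      unfolding dfs_step_def Let_def by (simp only: if_False if_True simp_thms)
    then show ?thesis using 3 by (intro pop) blast+
  next
    case 4
    then have "(SOME u. u \<in> ?C) \<in> ?C" by (meson ex_in_conv someI_ex)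
    moreover have "dfs_step V E F s = (if {last (hd (fst s)), SOME u. u \<in> ?C} \<in> F
        then ((hd (fst s) @ [SOME u. u \<in> ?C]) # fst s, snd s)
        else (fst s, insert {last (hd (fst s)), SOME u. u \<in> ?C} (snd s)))" for F
      unfolding dfs_step_def Let_def using 4 by (simp only: if_False if_True simp_thms)
    ultimately show ?thesis using 4(1) by (intro ask[of "SOME u. u \<in> ?C"]) blast+
  qed
qed

lemma visited_Cons: "visited (s # H) = set s \<union> visited H"
  by (simp add: visited_def)

lemma stack_trace_nonempty: "stack_trace H \<Longrightarrow> H \<noteq> []"
  by auto

lemma stack_trace_Cons:
  "H \<noteq> [] \<Longrightarrow> stack_trace (s # H) \<longleftrightarrow>
    ((\<exists>v. v \<notin> visited H \<and> s = hd H @ [v]) \<or> (hd H \<noteq> [] \<and> s = butlast (hd H))) \<and> stack_trace H"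
  by (cases H) simp_all

lemma stack_trace_last_nth: "stack_trace H \<Longrightarrow> rev H ! 0 = []"
  by (induction H rule: stack_trace.induct) (auto simp: nth_append)

lemma stack_trace_step:
  assumes "stack_trace H" "Suc i < length H"
  shows "(\<exists>v\<in>visited H. v \<notin> (\<Union>j\<le>i. set (rev H ! j)) \<and> rev H ! Suc i = rev H ! i @ [v]) \<or>
    (rev H ! i \<noteq> [] \<and> rev H ! Suc i = butlast (rev H ! i))"
  using assms
proof (induction H)
  case (Cons s H)
  then have H: "H \<noteq> []" by auto
  have old: "rev (s # H) ! j = rev H ! j" if "j < length H" for j using that by (simp add: nth_append)
  show ?case
  proof (cases "Suc i < length H")
    case True
    have "stack_trace H" using Cons.prems(1) H stack_trace_Cons by blast
    from Cons.IH[OF this True] show ?thesis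
      using True old by (auto simp: visited_Cons)
  next
    case False
    then have i: "Suc i = length H" using Cons.prems by simp
    then have "i < length H" by simp
    have new: "rev (s # H) ! Suc i = s" using i by (simp add: nth_append)
    have hd: "rev (s # H) ! i = hd H"
      using old[OF \<open>i < length H\<close>] i H by (simp add: rev_nth hd_conv_nth)
    have vis: "(\<Union>j\<le>i. set (rev (s # H) ! j)) \<subseteq> visited H"
    proof
      fix x assume "x \<in> (\<Union>j\<le>i. set (rev (s # H) ! j))"
      then obtain j where j: "j \<le> i" "x \<in> set (rev (s # H) ! j)" by auto
      then have "j < length H" using i by simp
      then have "rev (s # H) ! j \<in> set H" using old nth_mem[of j "rev H"] by simp
      then show "x \<in> visited H" using j(2) by (auto simp: visited_def)
    qed
    from Cons.prems(1) H have "(\<exists>v. v \<notin> visited H \<and> s = hd H @ [v]) \<or> (hd H \<noteq> [] \<and> s = butlast (hd H))"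
      using stack_trace_Cons by blast
    then show ?thesis
    proof
      assume "\<exists>v. v \<notin> visited H \<and> s = hd H @ [v]"
      then obtain v where v: "v \<notin> visited H" "s = hd H @ [v]" by blast
      then have "v \<in> visited (s # H)" "v \<notin> (\<Union>j\<le>i. set (rev (s # H) ! j))"
        using subsetD[OF vis, of v] by (auto simp only: visited_Cons set_append) simp
      then show ?thesis unfolding new hd using v(2) by (intro disjI1 bexI[of _ v] conjI)
    next
      assume "hd H \<noteq> [] \<and> s = butlast (hd H)"
      then show ?thesis unfolding new hd by (rule disjI2)
    qed
  qed
qed simp

text \<open>Reversing the history makes time run forwards, as a tour requires.\<close>

lemma tour_of_trace:
  assumes "stack_trace H"
  shows "tour (\<lambda>i. rev H ! i) (length H - 1) (visited H)"
proof
  show "rev H ! 0 = []" using assms by (rule stack_trace_last_nth)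
  show "finite (visited H)" by (simp add: visited_def)
  show "visited H \<subseteq> (\<Union>j\<le>length H - 1. set (rev H ! j))"
  proof
    fix x assume "x \<in> visited H"
    then obtain s where "s \<in> set (rev H)" "x \<in> set s" by (auto simp: visited_def)
    moreover from this obtain j where "j < length H" "rev H ! j = s" by (metis in_set_conv_nth length_rev)
    ultimately show "x \<in> (\<Union>j\<le>length H - 1. set (rev H ! j))" by (intro UN_I[of j]) auto
  qed
  show "(\<exists>v\<in>visited H. v \<notin> (\<Union>j\<le>i. set (rev H ! j)) \<and> rev H ! Suc i = rev H ! i @ [v]) \<or>
    (rev H ! i \<noteq> [] \<and> rev H ! Suc i = butlast (rev H ! i))" if "i < length H - 1" for i
    using stack_trace_step[OF assms, of i] that by linarith
qed

text \<open>The last clause is the property of depth-first search that matters: an edge at a vertex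
  that has left the stack either failed or joins two vertices that were once on the stack
  together.\<close>

definition dfs_inv :: "'a set \<Rightarrow> 'a set set \<Rightarrow> 'a set set \<Rightarrow> 'a list list \<times> 'a set set \<Rightarrow> bool" where
  "dfs_inv V E F s \<longleftrightarrow> stack_trace (fst s) \<and> visited (fst s) \<subseteq> V \<and> snd s \<subseteq> E \<and>
    (\<forall>t\<in>set (fst s). distinct t \<and> successively (\<lambda>a b. {a, b} \<in> F) t) \<and>
    (\<forall>v\<in>visited (fst s) - set (hd (fst s)). \<forall>u. {v, u} \<in> E \<longrightarrow>
       {v, u} \<in> snd s \<or> (\<exists>t\<in>set (fst s). u \<in> set t \<and> v \<in> set t))"

lemma dfs_invI:
  assumes "stack_trace H" "visited H \<subseteq> V" "N \<subseteq> E"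
    and "\<And>t. t \<in> set H \<Longrightarrow> distinct t \<and> successively (\<lambda>a b. {a, b} \<in> F) t"
    and "\<And>v u. v \<in> visited H \<Longrightarrow> v \<notin> set (hd H) \<Longrightarrow> {v, u} \<in> E \<Longrightarrow>
       {v, u} \<in> N \<or> (\<exists>t\<in>set H. u \<in> set t \<and> v \<in> set t)"
  shows "dfs_inv V E F (H, N)"
  using assms by (simp add: dfs_inv_def)

text \<open>Only a pop creates a new abandoned vertex, and it happens when every edge from that
  vertex to an unvisited one has failed.\<close>

lemma dfs_inv_step:
  assumes sg: "simple_graph V E" and inv: "dfs_inv V E F s"
  shows "dfs_inv V E F (dfs_step V E F s)"
proof -
  obtain H N where s: "s = (H, N)" by (cases s)
  have tr: "stack_trace H" and vis: "visited H \<subseteq> V" and NE: "N \<subseteq> E"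
    and path: "\<And>t. t \<in> set H \<Longrightarrow> distinct t \<and> successively (\<lambda>a b. {a, b} \<in> F) t"
    and finished: "\<And>v u. v \<in> visited H \<Longrightarrow> v \<notin> set (hd H) \<Longrightarrow> {v, u} \<in> E \<Longrightarrow>
       {v, u} \<in> N \<or> (\<exists>t\<in>set H. u \<in> set t \<and> v \<in> set t)"
    using inv unfolding dfs_inv_def s by auto
  have H: "H \<noteq> []" using stack_trace_nonempty[OF tr] .
  then have hdH: "hd H \<in> set H" by simp
  then have hdvis: "set (hd H) \<subseteq> visited H" by (auto simp: visited_def)
  show ?thesis
  proof (cases rule: dfs_step_cases[where s = s and V = V and E = E])
    case final
    then show ?thesis using inv by simp
  next
    case (root v)
    have step: "dfs_step V E F s = ([v] # H, N)" using root(3) s by simp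
    show ?thesis unfolding step
    proof (rule dfs_invI)
      show "stack_trace ([v] # H)" using root s tr H by (simp add: stack_trace_Cons)
      show "visited ([v] # H) \<subseteq> V" using vis root(2) by (auto simp: visited_Cons)
      show "distinct t \<and> successively (\<lambda>a b. {a, b} \<in> F) t" if "t \<in> set ([v] # H)" for t
        using that path by auto
      fix x u assume "x \<in> visited ([v] # H)" "x \<notin> set (hd ([v] # H))" "{x, u} \<in> E"
      then show "{x, u} \<in> N \<or> (\<exists>t\<in>set ([v] # H). u \<in> set t \<and> x \<in> set t)"
        using finished[of x u] root(1) s by (auto simp only: visited_Cons) auto
    qed (rule NE)
  next
    case pop
    let ?v = "last (hd H)"
    have ne: "hd H \<noteq> []" using pop s by simp
    have vin: "?v \<in> set (hd H)" using ne by simp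
    have set_hd: "set (hd H) = insert ?v (set (butlast (hd H)))"
      using arg_cong[OF append_butlast_last_id[OF ne], of set] by simp
    have vis_eq: "visited (butlast (hd H) # H) = visited H"
      using hdvis set_hd by (auto simp: visited_Cons)
    have "distinct (butlast (hd H))" using path[OF hdH] by (simp add: distinct_butlast)
    moreover have "successively (\<lambda>a b. {a, b} \<in> F) (butlast (hd H) @ [?v])"
      using path[OF hdH] ne by simp
    then have "successively (\<lambda>a b. {a, b} \<in> F) (butlast (hd H))"
      by (simp only: successively_append_iff)
    ultimately have path': "distinct t \<and> successively (\<lambda>a b. {a, b} \<in> F) t"
      if "t \<in> set (butlast (hd H) # H)" for t using that path by auto
    have finished': "{v, u} \<in> N \<or> (\<exists>t\<in>set H. u \<in> set t \<and> v \<in> set t)"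
      if v: "v \<in> visited H" "v \<notin> set (butlast (hd H))" and e: "{v, u} \<in> E" for v u
    proof (cases "v = ?v")
      case False
      then show ?thesis using finished v e set_hd by auto
    next
      case True
      \<comment> \<open>The edge was queried without success, or both ends are on the current stack,
        or \<open>u\<close> was abandoned earlier and the invariant applies with the ends
        exchanged.\<close>
      consider "u \<notin> visited H" | "u \<in> set (hd H)" | "u \<in> visited H" "u \<notin> set (hd H)" by blast
      then show ?thesis
      proof cases
        case 1
        have "u \<in> V" using e sg by (auto simp: simple_graph_def)
        then show ?thesis using pop(2)[of u] 1 e True s by auto
      next
        case 2
        then show ?thesis using vin hdH True by blast
      next
        case 3
        have "{u, v} \<in> E" using e by (simp add: insert_commute)
        from finished[OF 3 this] show ?thesis by (auto simp: insert_commute)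
      qed
    qed
    have step: "dfs_step V E F s = (butlast (hd H) # H, N)" using pop(3) s by simp
    show ?thesis unfolding step
    proof (rule dfs_invI[OF _ _ NE path'])
      show "stack_trace (butlast (hd H) # H)" using tr H ne by (simp add: stack_trace_Cons)
      show "visited (butlast (hd H) # H) \<subseteq> V" using vis vis_eq by simp
      fix x u assume "x \<in> visited (butlast (hd H) # H)" "x \<notin> set (hd (butlast (hd H) # H))" "{x, u} \<in> E"
      then have "{x, u} \<in> N \<or> (\<exists>t\<in>set H. u \<in> set t \<and> x \<in> set t)"
        unfolding vis_eq by (intro finished') simp_all
      then show "{x, u} \<in> N \<or> (\<exists>t\<in>set (butlast (hd H) # H). u \<in> set t \<and> x \<in> set t)" by auto
    qed
  next
    case (ask u)
    let ?v = "last (hd H)"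
    have u: "u \<in> V" "u \<notin> visited H" "hd H \<noteq> []" "{?v, u} \<in> E" using ask s by auto
    show ?thesis
    proof (cases "{?v, u} \<in> F")
      case True
      have step: "dfs_step V E F s = ((hd H @ [u]) # H, N)" using ask(4)[of F] True s by simp
      have vis_eq: "visited ((hd H @ [u]) # H) = insert u (visited H)"
        using hdvis by (auto simp: visited_Cons)
      have "distinct (hd H @ [u])" using path[OF hdH] hdvis u by auto
      moreover have "successively (\<lambda>a b. {a, b} \<in> F) (hd H @ [u])"
        using path[OF hdH] True u by (simp add: successively_append_iff)
      ultimately have path': "distinct t \<and> successively (\<lambda>a b. {a, b} \<in> F) t"
        if "t \<in> set ((hd H @ [u]) # H)" for t using that path by auto
      show ?thesis unfolding step
      proof (rule dfs_invI[OF _ _ NE path'])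
        show "stack_trace ((hd H @ [u]) # H)" using tr H u by (simp add: stack_trace_Cons)
        show "visited ((hd H @ [u]) # H) \<subseteq> V" using vis u by (simp add: vis_eq)
        fix x y assume "x \<in> visited ((hd H @ [u]) # H)" "x \<notin> set (hd ((hd H @ [u]) # H))" "{x, y} \<in> E"
        then have "{x, y} \<in> N \<or> (\<exists>t\<in>set H. y \<in> set t \<and> x \<in> set t)"
          unfolding vis_eq by (intro finished) auto
        then show "{x, y} \<in> N \<or> (\<exists>t\<in>set ((hd H @ [u]) # H). y \<in> set t \<and> x \<in> set t)" by auto
      qed
    next
      case False
      have step: "dfs_step V E F s = (H, insert {?v, u} N)" using ask(4)[of F] False s by simp
      show ?thesis unfolding step
      proof (rule dfs_invI[OF tr vis _ path])
        show "insert {?v, u} N \<subseteq> E" using NE u by simp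
        fix x y assume "x \<in> visited H" "x \<notin> set (hd H)" "{x, y} \<in> E"
        from finished[OF this]
        show "{x, y} \<in> insert {?v, u} N \<or> (\<exists>t\<in>set H. y \<in> set t \<and> x \<in> set t)" by blast
      qed
    qed
  qed
qed

section \<open>Termination of the search and the resulting tour\<close>

lemma dfs_inv_init: "dfs_inv V E F ([[]], {})"
  by (simp add: dfs_inv_def visited_def)

text \<open>Every step before the end either extends the history or adds a failed query. There are
  at most \<open>2 * card V\<close> steps of the first kind and \<open>card E\<close> of the second,
  so this number of iterations reaches the end.\<close>

definition dfs_run :: "'a set \<Rightarrow> 'a set set \<Rightarrow> 'a set set \<Rightarrow> 'a list list \<times> 'a set set" where
  "dfs_run V E F = (dfs_step V E F ^^ (2 * card V + card E + 1)) ([[]], {})"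

lemma dfs_inv_funpow:
  assumes "simple_graph V E"
  shows "dfs_inv V E F ((dfs_step V E F ^^ i) ([[]], {}))"
  by (induction i) (simp_all add: dfs_inv_init dfs_inv_step[OF assms])

lemma dfs_progress:
  assumes sg: "simple_graph V E" and fin: "finite V" "finite E"
  shows "(let s = (dfs_step V E F ^^ i) ([[]], {}) in
    (hd (fst s) = [] \<and> V \<subseteq> visited (fst s)) \<or> i + 1 \<le> length (fst s) + card (snd s))"
proof (induction i)
  case (Suc i)
  define s where "s = (dfs_step V E F ^^ i) ([[]], {})"
  have inv: "dfs_inv V E F s" unfolding s_def by (rule dfs_inv_funpow[OF sg])
  then have "snd s \<subseteq> E" by (simp add: dfs_inv_def)
  then have fN: "finite (snd s)" using fin finite_subset by blast
  have *: "(hd (fst s) = [] \<and> V \<subseteq> visited (fst s)) \<or> i + 1 \<le> length (fst s) + card (snd s)"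
    using Suc by (simp add: s_def Let_def)
  have "(hd (fst (dfs_step V E F s)) = [] \<and> V \<subseteq> visited (fst (dfs_step V E F s))) \<or>
      Suc i + 1 \<le> length (fst (dfs_step V E F s)) + card (snd (dfs_step V E F s))"
  proof (cases rule: dfs_step_cases[where s = s and V = V and E = E])
    case final
    then show ?thesis by simp
  next
    case (root v)
    then show ?thesis using * by auto
  next
    case pop
    then show ?thesis using * by auto
  next
    case (ask u)
    then show ?thesis using * fN by auto
  qed
  then show ?case by (simp add: s_def Let_def)
qed simp

lemma dfs_run_final:
  assumes sg: "simple_graph V E" and fin: "finite V"
  shows "hd (fst (dfs_run V E F)) = []" "visited (fst (dfs_run V E F)) = V"
proof -
  have "E \<subseteq> Pow V" using sg by (auto simp: simple_graph_def)
  then have fE: "finite E" using fin by (simp add: finite_subset)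
  define s where "s = dfs_run V E F"
  have inv: "dfs_inv V E F s" unfolding s_def dfs_run_def by (rule dfs_inv_funpow[OF sg])
  then have tr: "stack_trace (fst s)" and vis: "visited (fst s) \<subseteq> V" and N: "snd s \<subseteq> E"
    by (simp_all add: dfs_inv_def)
  interpret tour "\<lambda>i. rev (fst s) ! i" "length (fst s) - 1" "visited (fst s)"
    by (rule tour_of_trace[OF tr])
  have "length (fst s) - 1 \<le> 2 * card V" using T_le card_mono[OF fin vis] by linarith
  moreover have "card (snd s) \<le> card E" using card_mono[OF fE N] .
  ultimately have "hd (fst s) = [] \<and> V \<subseteq> visited (fst s)"
    using dfs_progress[OF sg fin fE, where F = F and i = "2 * card V + card E + 1"] unfolding s_def dfs_run_def Let_def by linarith
  then show "hd (fst (dfs_run V E F)) = []" "visited (fst (dfs_run V E F)) = V"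
    using vis by (auto simp: s_def)
qed

lemma (in tour) comparable_if_same_stack:
  assumes "j \<le> T" "u \<in> set (st j)" "v \<in> set (st j)" shows "comparable u v"
proof -
  have *: "x \<in> set (stem y)" if "x \<in> set (st j)" "y \<in> set (st j)" "dep x \<le> dep y" for x y
  proof -
    note x = stem_eq_take(2-4)[OF assms(1) that(1)] and y = stem_eq_take[OF assms(1) that(2)]
    have "take (dep y) (st j) ! (dep x - 1) = x" using x that(3) by simp
    moreover have "dep x - 1 < length (take (dep y) (st j))" using x(1) y(3) that(3) by simp
    ultimately have "x \<in> set (take (dep y) (st j))" by (metis nth_mem)
    then show ?thesis by (subst y(1))
  qed
  show ?thesis
    using *[OF assms(2,3)] *[OF assms(3,2)] nat_le_linear[of "dep u" "dep v"] unfolding comparable_def by argo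
qed

text \<open>At the end of the run all of \<open>V\<close> has been visited and the stack is empty,
  so the last clause of the invariant speaks about every edge of the graph.\<close>

lemma dfs_tour:
  assumes sg: "simple_graph V E" and fin: "finite V"
  obtains st T where "tour st T V"
    "\<And>j. j \<le> T \<Longrightarrow> successively (\<lambda>a b. {a, b} \<in> F) (st j)"
    "\<And>u v. {u, v} \<in> E \<Longrightarrow> {u, v} \<in> snd (dfs_run V E F) \<or> tour.comparable st u v"
    "snd (dfs_run V E F) \<subseteq> E"
proof -
  define s where "s = dfs_run V E F"
  have inv: "dfs_inv V E F s" unfolding s_def dfs_run_def by (rule dfs_inv_funpow[OF sg])
  then have tr: "stack_trace (fst s)" and N: "snd s \<subseteq> E" by (simp_all add: dfs_inv_def)
  have fin': "hd (fst s) = []" "visited (fst s) = V" using dfs_run_final[OF sg fin] by (simp_all add: s_def)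
  let ?st = "\<lambda>i. rev (fst s) ! i" and ?T = "length (fst s) - 1"
  have tour: "tour ?st ?T V" using tour_of_trace[OF tr] fin' by simp
  interpret tour ?st ?T V by (rule tour)
  have lt: "j < length (rev (fst s))" if "j \<le> ?T" for j
    using that stack_trace_nonempty[OF tr] by (cases "fst s") auto
  show thesis
  proof (rule that[OF tour])
    fix j assume "j \<le> ?T"
    then have "rev (fst s) ! j \<in> set (fst s)" using nth_mem[OF lt] by simp
    then show "successively (\<lambda>a b. {a, b} \<in> F) (rev (fst s) ! j)"
      using inv by (simp add: dfs_inv_def)
  next
    fix u v assume e: "{u, v} \<in> E"
    then have "u \<in> V" using sg by (auto simp: simple_graph_def)
    then have "{u, v} \<in> snd s \<or> (\<exists>t\<in>set (fst s). v \<in> set t \<and> u \<in> set t)"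
      using inv e fin' by (simp add: dfs_inv_def)
    moreover have "comparable u v" if t: "t \<in> set (fst s)" "v \<in> set t" "u \<in> set t" for t
    proof -
      obtain j where "j < length (fst s)" "rev (fst s) ! j = t"
        using t(1) by (metis in_set_conv_nth length_rev set_rev)
      then show ?thesis using t by (intro comparable_if_same_stack[of j]) auto
    qed
    ultimately show "{u, v} \<in> snd (dfs_run V E F) \<or> comparable u v" by (auto simp: s_def)
  qed (use N in \<open>simp add: s_def\<close>)
qed

section \<open>Random subgraphs\<close>

lemma random_subgraph_empty: "random_subgraph {} p = return_pmf {}"
  by (simp add: random_subgraph_def)

lemma random_subgraph_insert:
  assumes "finite U" "e \<notin> U"
  shows "random_subgraph (insert e U) p =
    bind_pmf (bernoulli_pmf p) (\<lambda>b. map_pmf (\<lambda>F. if b then insert e F else F) (random_subgraph U p))"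
  unfolding random_subgraph_def Pi_pmf_insert'[OF assms] map_bind_pmf map_return_pmf map_pmf_comp map_pmf_def[of _ "Pi_pmf U _ _"]
    bind_assoc_pmf bind_return_pmf
  apply (rule bind_pmf_cong[OF refl])
  apply (rule bind_pmf_cong[OF refl])
  subgoal for b f using assms(2) by (auto simp: map_pmf_def bind_return_pmf)
  done

lemma prob_random_subgraph_insert:
  assumes "finite U" "e \<notin> U" "0 \<le> p" "p \<le> 1"
  shows "measure_pmf.prob (random_subgraph (insert e U) p) {F. P F} =
    p * measure_pmf.prob (random_subgraph U p) {F. P (insert e F)} +
    (1 - p) * measure_pmf.prob (random_subgraph U p) {F. P F}"
proof -
  have "emeasure (random_subgraph (insert e U) p) {F. P F} =
     ennreal (p * measure_pmf.prob (random_subgraph U p) {F. P (insert e F)} +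
    (1 - p) * measure_pmf.prob (random_subgraph U p) {F. P F})"
    unfolding random_subgraph_insert[OF assms(1,2)] emeasure_bind_pmf emeasure_map_pmf
      nn_integral_bernoulli_pmf[OF assms(3,4) zero_le]
    using assms(3,4)
    by (simp add: measure_pmf.emeasure_eq_measure ennreal_mult' ennreal_plus vimage_def mult.commute)
  then show ?thesis
    using assms unfolding measure_pmf.emeasure_eq_measure by (subst (asm) ennreal_inj) auto
qed

text \<open>Sprinkling: an edge is absent from the union exactly if both independent copies miss it.
  Induction adds one edge at a time and commutes the independent choices.\<close>

lemma random_subgraph_union:
  assumes "finite E" "0 \<le> q" "q \<le> 1" "1 - p = (1 - q)\<^sup>2"
  shows "random_subgraph E p =
    bind_pmf (random_subgraph E q) (\<lambda>F1. map_pmf (\<lambda>F2. F1 \<union> F2) (random_subgraph E q))"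
proof -
  have p: "0 \<le> p" "p \<le> 1"
  proof -
    have "(1 - q)\<^sup>2 \<le> 1" using assms by (simp add: power_le_one)
    then show "0 \<le> p" using assms by simp
    show "p \<le> 1" using assms(4) zero_le_power2[of "1 - q"] by linarith
  qed
  have bern: "bernoulli_pmf p = bind_pmf (bernoulli_pmf q) (\<lambda>a. map_pmf (\<lambda>b. a \<or> b) (bernoulli_pmf q))"
  proof (rule pmf_eqI)
    have "(\<or>) True = (\<lambda>_. True)" "(\<or>) False = (\<lambda>b. b)" by auto
    then have "pmf (bind_pmf (bernoulli_pmf q) (\<lambda>a. map_pmf (\<lambda>b. a \<or> b) (bernoulli_pmf q))) False = (1 - q)\<^sup>2"
      using assms by (simp add: pmf_bind power2_eq_square)
    moreover from this have "pmf (bind_pmf (bernoulli_pmf q) (\<lambda>a. map_pmf (\<lambda>b. a \<or> b) (bernoulli_pmf q))) True = 1 - (1 - q)\<^sup>2"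
      by (simp add: pmf_True_conv_False)
    ultimately show "pmf (bernoulli_pmf p) x = pmf (bind_pmf (bernoulli_pmf q) (\<lambda>a. map_pmf (\<lambda>b. a \<or> b) (bernoulli_pmf q))) x" for x
      using assms p by (cases x) auto
  qed
  show ?thesis using assms(1)
  proof (induction E rule: finite_induct)
    case (insert e U)
    let ?R = "random_subgraph U q" and ?B = "bernoulli_pmf q"
    let ?i = "\<lambda>b F. if b then insert e F else F"
    have "random_subgraph (insert e U) p =
      bind_pmf ?B (\<lambda>a. bind_pmf ?B (\<lambda>b. bind_pmf ?R (\<lambda>F1. bind_pmf ?R (\<lambda>F2. return_pmf (?i (a \<or> b) (F1 \<union> F2))))))"
      unfolding random_subgraph_insert[OF insert(1,2)] insert(3) bern
      by (simp add: map_pmf_def bind_assoc_pmf bind_return_pmf)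
    also have "\<dots> = bind_pmf ?B (\<lambda>a. bind_pmf ?R (\<lambda>F1. bind_pmf ?B (\<lambda>b. bind_pmf ?R (\<lambda>F2. return_pmf (?i (a \<or> b) (F1 \<union> F2))))))"
      by (subst (2) bind_commute_pmf) (rule refl)
    also have "\<dots> = bind_pmf ?B (\<lambda>a. bind_pmf ?R (\<lambda>F1. bind_pmf ?B (\<lambda>b. bind_pmf ?R (\<lambda>F2. return_pmf (?i a F1 \<union> ?i b F2)))))"
    proof -
      have "?i (a \<or> b) (F1 \<union> F2) = ?i a F1 \<union> ?i b F2" for a b F1 F2 by auto
      then show ?thesis by presburger
    qed
    also have "\<dots> = bind_pmf (random_subgraph (insert e U) q) (\<lambda>F1. map_pmf (\<lambda>F2. F1 \<union> F2) (random_subgraph (insert e U) q))"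
      unfolding random_subgraph_insert[OF insert(1,2)]
      by (simp add: map_pmf_def bind_assoc_pmf bind_return_pmf)
    finally show ?case .
  qed (simp add: random_subgraph_empty bind_return_pmf)
qed

section \<open>Missing a set of edges, and many failed queries\<close>

lemma prob_random_subgraph_avoids:
  assumes "finite E" "C \<subseteq> E" "0 \<le> q" "q \<le> 1"
  shows "measure_pmf.prob (random_subgraph E q) {F. F \<inter> C = {}} = (1 - q) ^ card C"
proof -
  have "measure_pmf.prob (random_subgraph E q) {F. F \<inter> C = {}} =
      measure_pmf.prob (Pi_pmf E False (\<lambda>_. bernoulli_pmf q)) (Pi E (\<lambda>e. if e \<in> C then {False} else UNIV))"
    unfolding random_subgraph_def measure_map_pmf
    using assms(2) by (intro arg_cong[where f = "measure_pmf.prob _"]) (auto simp: Pi_def)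
  also have "\<dots> = (\<Prod>e\<in>E. measure_pmf.prob (bernoulli_pmf q) (if e \<in> C then {False} else UNIV))"
    by (rule measure_Pi_pmf_Pi[OF assms(1)])
  also have "\<dots> = (\<Prod>e\<in>E. if e \<in> C then 1 - q else 1)"
    using assms by (intro prod.cong refl) (auto simp: measure_pmf_single)
  also have "\<dots> = (\<Prod>e\<in>E \<inter> C. 1 - q)" by (rule prod.inter_restrict[OF assms(1), symmetric])
  also have "\<dots> = (1 - q) ^ card C" using assms(2) by (simp add: Int_absorb1)
  finally show ?thesis .
qed

text \<open>Contains every edge that the search can still query from this state; the edges outside
  it need not be random any more.\<close>

definition available :: "'a set \<Rightarrow> 'a set set \<Rightarrow> 'a list list \<times> 'a set set \<Rightarrow> 'a set set" where
  "available V E s = {f \<in> E - snd s. f \<inter> (V - visited (fst s)) \<noteq> {}}"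

text \<open>Only the edges in \<open>U\<close> are still random; \<open>B\<close> is the outcome of the earlier queries. The bound is a
  supermartingale: a hit halves the first factor, a miss enlarges the second one.\<close>

lemma random_dfs_many_failures:
  assumes q: "0 \<le> q" "q \<le> 1" and fV: "finite V"
  shows "\<lbrakk>finite U; available V E s \<subseteq> U; finite (snd s); fst s \<noteq> []\<rbrakk> \<Longrightarrow>
    measure_pmf.prob (random_subgraph U q) {F. x \<le> card (snd ((dfs_step V E (B \<union> F) ^^ i) s))}
    \<le> 2 ^ card (V - visited (fst s)) * (1 - q / 2) ^ (x - card (snd s))"
proof (induction i arbitrary: s U B)
  case 0
  show ?case
  proof (cases "x \<le> card (snd s)")
    case True
    then show ?thesis by (simp add: measure_pmf.prob_le_1 order_trans[OF measure_pmf.prob_le_1])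
  qed (use q in simp)
next
  case (Suc i)
  let ?bd = "\<lambda>s. 2 ^ card (V - visited (fst s)) * (1 - q / 2) ^ (x - card (snd s))"
  let ?ev = "\<lambda>B s F. x \<le> card (snd ((dfs_step V E (B \<union> F) ^^ i) s))"
  have fR: "finite (V - visited (fst s))" using fV by simp
  have pw: "0 \<le> (1 - q / 2) ^ j" for j using q by simp
  \<comment> \<open>Covers the steps that query nothing: the bound does not increase and no edge is
    revealed.\<close>
  have det: ?case if s': "\<And>F. dfs_step V E F s = s'" and "available V E s' \<subseteq> available V E s"
    "snd s' = snd s" "fst s' \<noteq> []" "visited (fst s) \<subseteq> visited (fst s')" for s'
  proof -
    have "measure_pmf.prob (random_subgraph U q) {F. ?ev B s' F} \<le> ?bd s'"
      using Suc.prems that by (intro Suc.IH) auto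
    also have "\<dots> \<le> ?bd s"
    proof -
      have "card (V - visited (fst s')) \<le> card (V - visited (fst s))"
        using that fR by (intro card_mono) auto
      then show ?thesis unfolding that(3) using pw by (intro mult_right_mono power_increasing) auto
    qed
    finally show ?thesis by (simp add: funpow_Suc_right s' del: funpow.simps)
  qed
  show ?case
  proof (cases rule: dfs_step_cases[where s = s and V = V and E = E])
    case final
    then show ?thesis using Suc.prems by (intro det[of s]) auto
  next
    case (root v)
    then show ?thesis
      by (intro det[of "([v] # fst s, snd s)"]) (auto simp: available_def visited_Cons)
  next
    case pop
    then show ?thesis
      by (intro det[of "(butlast (hd (fst s)) # fst s, snd s)"]) (auto simp: available_def visited_Cons)
  next
    case (ask u)
    let ?e = "{last (hd (fst s)), u}"
    define s1 where "s1 = ((hd (fst s) @ [u]) # fst s, snd s)"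
    define s2 where "s2 = (fst s, insert ?e (snd s))"
    have step: "dfs_step V E F s = (if ?e \<in> F then s1 else s2)" for F using ask(4) by (simp add: s1_def s2_def)
    have e: "?e \<in> available V E s" using ask by (auto simp: available_def)
    then have eU: "?e \<in> U" using Suc.prems by blast
    define U' where "U' = U - {?e}"
    have U: "U = insert ?e U'" "?e \<notin> U'" "finite U'" using eU Suc.prems by (auto simp: U'_def)
    have hdvis: "set (hd (fst s)) \<subseteq> visited (fst s)"
      using hd_in_set[OF Suc.prems(4)] by (auto simp: visited_def)
    then have lastin: "last (hd (fst s)) \<in> visited (fst s)" using ask(1) by auto
    \<comment> \<open>After a hit both ends of the edge are visited, so it is never queried
      again.\<close>
    have av1: "available V E s1 \<subseteq> U'"
      using Suc.prems(2) lastin ask hdvis by (auto simp: available_def s1_def U'_def visited_Cons)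
    have av2: "available V E s2 \<subseteq> U'"
      using Suc.prems(2) by (auto simp: available_def s2_def U'_def)
    have run: "(dfs_step V E F ^^ Suc i) s = (dfs_step V E F ^^ i) (if ?e \<in> F then s1 else s2)" for F
      by (simp add: funpow_Suc_right step del: funpow.simps)
    show ?thesis
    proof (cases "?e \<in> B")
      \<comment> \<open>The edge is known to be present, so the step is a hit whatever the random
        part is.\<close>
      case True
      have vis1: "V - visited (fst s1) \<subseteq> V - visited (fst s)" by (auto simp: s1_def visited_Cons)
      have "measure_pmf.prob (random_subgraph U q) {F. ?ev B s1 F} \<le> ?bd s1"
        using Suc.prems av1 by (intro Suc.IH) (auto simp: U'_def s1_def)
      also have "\<dots> \<le> ?bd s"
      proof -
        have "snd s1 = snd s" by (simp add: s1_def)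
        then show ?thesis using card_mono[OF fR vis1] pw by (simp add: mult_right_mono power_increasing)
      qed
      finally show ?thesis using True unfolding run by simp
    next
      case False
      have card1: "card (V - visited (fst s)) = Suc (card (V - visited (fst s1)))"
      proof -
        have "V - visited (fst s1) = (V - visited (fst s)) - {u}"
          using hdvis by (auto simp: s1_def visited_Cons)
        then show ?thesis using card_Suc_Diff1[OF fR ask(2)] by metis
      qed
      have card2: "card (snd s2) = Suc (card (snd s))" using ask(3) Suc.prems(3) by (simp add: s2_def)
      have P1: "measure_pmf.prob (random_subgraph U' q) {F. ?ev (insert ?e B) s1 F} \<le> ?bd s1"
        using Suc.prems av1 U by (intro Suc.IH) (auto simp: s1_def)
      have P2: "measure_pmf.prob (random_subgraph U' q) {F. ?ev B s2 F} \<le> ?bd s2"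
        using Suc.prems av2 U by (intro Suc.IH) (auto simp: s2_def)
      \<comment> \<open>With the queried edge removed from the random part, the branch in which it
        is absent almost surely moves to \<open>s2\<close>.\<close>
      have not_e: "AE F in random_subgraph U' q. ?e \<notin> F"
        using U(2) by (auto simp: AE_measure_pmf_iff random_subgraph_def)
      have "measure_pmf.prob (random_subgraph U q) {F. x \<le> card (snd ((dfs_step V E (B \<union> F) ^^ Suc i) s))} =
        q * measure_pmf.prob (random_subgraph U' q) {F. x \<le> card (snd ((dfs_step V E (B \<union> insert ?e F) ^^ Suc i) s))} +
        (1 - q) * measure_pmf.prob (random_subgraph U' q) {F. x \<le> card (snd ((dfs_step V E (B \<union> F) ^^ Suc i) s))}"
        unfolding U(1) by (rule prob_random_subgraph_insert[OF U(3,2) q])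
      also have "measure_pmf.prob (random_subgraph U' q) {F. x \<le> card (snd ((dfs_step V E (B \<union> insert ?e F) ^^ Suc i) s))}
          = measure_pmf.prob (random_subgraph U' q) {F. ?ev (insert ?e B) s1 F}"
        unfolding run by simp
      also have "measure_pmf.prob (random_subgraph U' q) {F. x \<le> card (snd ((dfs_step V E (B \<union> F) ^^ Suc i) s))}
          = measure_pmf.prob (random_subgraph U' q) {F. ?ev B s2 F}"
        unfolding run using not_e False by (intro measure_pmf.finite_measure_eq_AE) (auto elim!: eventually_mono)
      also have "q * measure_pmf.prob (random_subgraph U' q) {F. ?ev (insert ?e B) s1 F} +
        (1 - q) * measure_pmf.prob (random_subgraph U' q) {F. ?ev B s2 F} \<le> q * ?bd s1 + (1 - q) * ?bd s2"
        using P1 P2 q by (intro add_mono mult_left_mono) auto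
      also have "\<dots> \<le> ?bd s"
      proof -
        define r where "r = card (V - visited (fst s1))"
        define y where "y = x - card (snd s)"
        have s1: "?bd s1 = 2 ^ r * (1 - q / 2) ^ y" by (simp add: r_def y_def s1_def)
        have s2: "?bd s2 = 2 * 2 ^ r * (1 - q / 2) ^ (y - 1)"
          using card1 card2 by (simp add: r_def y_def s2_def)
        have s: "?bd s = 2 * 2 ^ r * (1 - q / 2) ^ y" using card1 by (simp add: r_def y_def)
        have "q * (2 ^ r * (1 - q / 2) ^ y) + (1 - q) * (2 * 2 ^ r * (1 - q / 2) ^ (y - 1)) \<le> 2 * 2 ^ r * (1 - q / 2) ^ y"
        proof (cases y)
          case 0
          then show ?thesis using q by (simp add: algebra_simps)
        next
          case (Suc z)
          \<comment> \<open>This quantity is exactly the difference between the two sides of the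
            claim.\<close>
          have "0 \<le> 2 ^ r * (1 - q / 2) ^ z * (q\<^sup>2 / 2)" using pw by simp
          then show ?thesis unfolding Suc by (simp add: algebra_simps power2_eq_square)
        qed
        then show ?thesis unfolding s1 s2 s .
      qed
      finally show ?thesis .
    qed
  qed
qed

text \<open>Initially all vertices are unvisited and no query has failed, which turns the general
  bound into this one.\<close>

lemma prob_dfs_run_failures:
  assumes "0 \<le> q" "q \<le> 1" "finite V" "simple_graph V E"
  shows "measure_pmf.prob (random_subgraph E q) {F. x \<le> card (snd (dfs_run V E F))}
    \<le> 2 ^ card V * (1 - q / 2) ^ x"
proof -
  have "E \<subseteq> Pow V" using assms(4) by (auto simp: simple_graph_def)
  then have "finite E" using assms(3) by (simp add: finite_subset)
  then show ?thesis
    using random_dfs_many_failures[OF assms(1-3), where U = E and E = E and s = "([[]], {})" and x = x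
        and B = "{}" and i = "2 * card V + card E + 1"]
    by (simp add: dfs_run_def available_def visited_def del: funpow.simps)
qed

section \<open>Long cycles\<close>

text \<open>The part of the stem from \<open>x\<close> to \<open>y\<close>, closed by the chord;
  \<open>2 \<le> m\<close> gives it at least three vertices.\<close>

lemma (in tour) cycle_of_long_chord:
  assumes y: "y \<in> V" and x: "x \<in> set (stem y)" and far: "dep x + m \<le> dep y" and m: "2 \<le> m"
    and path: "successively (\<lambda>a b. {a, b} \<in> F) (stem y)" and chord: "{x, y} \<in> F"
  shows "\<exists>xs. is_cycle F xs \<and> m \<le> length xs"
proof -
  let ?xs = "drop (dep x - 1) (stem y)"
  note dx = stem_ancestor(2-4)[OF y x]
  have len: "length ?xs = dep y - (dep x - 1)" by (simp add: dep_def[of y])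
  have ne: "dep x - 1 < length (stem y)" using dx(1,2) by (simp add: dep_def[of y])
  have "is_cycle F ?xs"
  proof (rule is_cycleI)
    show "3 \<le> length ?xs" using len far m dx by linarith
    show "distinct ?xs" using distinct_stem[OF y] by simp
    have "successively (\<lambda>a b. {a, b} \<in> F) (take (dep x - 1) (stem y) @ ?xs)" using path by simp
    then show "successively (\<lambda>a b. {a, b} \<in> F) ?xs" by (simp only: successively_append_iff)
    have "hd ?xs = x" using ne dx(3) by (simp add: hd_drop_conv_nth)
    moreover have "last ?xs = y"
    proof -
      have "stem y \<noteq> []" using ne by auto
      then show ?thesis using ne stem_last[OF y] by (simp add: last_conv_nth dep_def[of y])
    qed
    ultimately show "{last ?xs, hd ?xs} \<in> F" using chord by (simp add: insert_commute)
  qed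
  moreover have "m \<le> length ?xs" using len far by linarith
  ultimately show ?thesis by blast
qed

text \<open>The family depends on the first copy \<open>F\<close> alone, so a second independent
  copy \<open>F'\<close> can be tested against it. It is either the set of long chords at one
  vertex, or one set of upward chords for each of the \<open>J\<close> segments of a long path. In
  \<open>few\<close>, the variables bound the numbers of vertices that are not full, poor and
  minimal rich.\<close>

lemma hitting_family:
  fixes V :: "'a set" and k e m w b M J x :: nat
  assumes fin: "finite V" and sg: "simple_graph V E" and C4: "C4_free E"
    and deg: "\<forall>v\<in>V. k \<le> card (nbrs E v)"
    and fail: "card (snd (dfs_run V E F)) \<le> x"
    and kst: "(m + 9 * w) * ((k - 3 * e) + b) < (k - 3 * e)\<^sup>2 * b"
    and w: "0 < w" and m: "2 \<le> m" and bw: "2 * b \<le> w"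
    and J: "0 < J" "J * w + m \<le> M" "2 * m \<le> (J - 1) * w"
    and few: "\<forall>nf pr mr. e * nf \<le> 2 * x \<longrightarrow> pr \<le> nf + b * (2 * card V div w + 1) \<longrightarrow> w * mr \<le> pr \<longrightarrow>
      (pr + M * mr) * (M + 1 + w) + 2 * (M + 1) * nf < w * card V"
  shows "\<exists>\<C>. finite \<C> \<and> card \<C> \<le> J \<and> (\<forall>C\<in>\<C>. C \<subseteq> E \<and> e \<le> card C) \<and>
    (\<forall>F'. (\<forall>C\<in>\<C>. F' \<inter> C \<noteq> {}) \<longrightarrow> (\<exists>xs. is_cycle (F \<union> F') xs \<and> m \<le> length xs))"
proof -
  obtain st T where tour: "tour st T V"
    and path: "\<And>j. j \<le> T \<Longrightarrow> successively (\<lambda>a b. {a, b} \<in> F) (st j)"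
    and comparable: "\<And>u v. {u, v} \<in> E \<Longrightarrow> {u, v} \<in> snd (dfs_run V E F) \<or> tour.comparable st u v"
    and NE: "snd (dfs_run V E F) \<subseteq> E"
    by (rule dfs_tour[OF sg fin, of F]) (rule that, blast+)
  interpret tour st T V by (rule tour)
  let ?long = "\<lambda>v. {u \<in> nbrs E v. comparable u v \<and> (dep u + m \<le> dep v \<or> dep v + m \<le> dep u)}"
  have path_stem: "successively (\<lambda>a b. {a, b} \<in> F \<union> F') (stem v)" if "v \<in> V" for v F'
    using successively_mono[OF path[OF push_le_T[OF that]]] by (simp add: stem_def)
  show ?thesis
  proof (cases "\<exists>v\<in>V. e \<le> card (?long v)")
    case True
    then obtain v where v: "v \<in> V" "e \<le> card (?long v)" by blast
    let ?C = "(\<lambda>u. {v, u}) ` ?long v"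
    have "card ?C = card (?long v)" by (intro card_image) (auto simp: inj_on_def doubleton_eq_iff)
    moreover have "?C \<subseteq> E" by (auto simp: nbrs_def)
    moreover have "\<exists>xs. is_cycle (F \<union> F') xs \<and> m \<le> length xs" if hit: "F' \<inter> ?C \<noteq> {}" for F'
    proof -
      obtain u where u: "u \<in> ?long v" "{v, u} \<in> F'" using hit by blast
      then have uV: "u \<in> V" using nbrs_subset[OF sg] by blast
      have e: "{u, v} \<in> F \<union> F'" "{v, u} \<in> F \<union> F'" using u(2) by (auto simp: insert_commute)
      from u(1) have cmp: "u \<in> set (stem v) \<or> v \<in> set (stem u)" "dep u + m \<le> dep v \<or> dep v + m \<le> dep u"
        by (auto simp: comparable_def)
      show ?thesis
      proof (cases "dep u + m \<le> dep v")
        case True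
        then have "u \<in> set (stem v)" using cmp(1) stem_ancestor(3)[OF uV, of v] m by linarith
        then show ?thesis using cycle_of_long_chord[OF v(1) _ True m path_stem[OF v(1)] e(1)] by simp
      next
        case False
        then have d: "dep v + m \<le> dep u" using cmp by simp
        then have "v \<in> set (stem u)" using cmp(1) stem_ancestor(3)[OF v(1), of u] m by linarith
        then show ?thesis using cycle_of_long_chord[OF uV _ d m path_stem[OF uV] e(2)] by simp
      qed
    qed
    ultimately show ?thesis using J(1) v(2) by (intro exI[of _ "{?C}"]) simp
  next
    case False
    \<comment> \<open>No vertex has \<open>e\<close> long chords, so the structural results on the
      forest apply with the failed queries as \<open>N\<close>.\<close>
    interpret C4_free_tour st T V E "snd (dfs_run V E F)" k e m w b M
    proof
      show "card (?long v) < e" if "v \<in> V" for v using False that by force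
    qed (use sg C4 deg NE comparable kst w m bw in auto)
    let ?nf = "card {v \<in> V. \<not> full v}" and ?pr = "card {v \<in> V. poor v}"
      and ?mr = "card {x \<in> V. minimal_rich x}"
    have "card {v \<in> V. low v} * (M + 1 + w) + 2 * (M + 1) * ?nf
        \<le> (?pr + M * ?mr) * (M + 1 + w) + 2 * (M + 1) * ?nf"
      by (intro add_right_mono mult_right_mono card_low) simp
    also have "\<dots> < w * card V"
      using card_not_full fail by (intro few[rule_format] card_poor card_minimal_rich) linarith
    finally obtain v z where v: "v \<in> V" and z: "z \<in> V" and vz: "v \<in> set (stem z)" and dz: "dep z = dep v + M"
      and light: "card (below v) + 2 * card (below v \<inter> {v \<in> V. \<not> full v}) \<le> M + 1 + w"
      by (rule ex_light)
    define Z where "Z = stem z"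
    define p0 where "p0 = dep v - 1"
    let ?I = "\<lambda>g. {i. i + 6 * w \<le> g \<and> {Z ! i, Z ! g} \<in> E}"
    have dZ: "distinct Z" unfolding Z_def by (rule distinct_stem[OF z])
    have len: "p0 + J * w \<le> length Z"
      using dz J(2) dep_pos[OF v] by (simp add: Z_def p0_def dep_def)
    have "\<forall>j\<in>{..<J}. \<exists>g. p0 + j * w \<le> g \<and> g < p0 + (j + 1) * w \<and> e \<le> card (?I g)"
    proof
      fix j assume "j \<in> {..<J}"
      then have "(j + 1) * w \<le> J * w" by (intro mult_right_mono) auto
      then have "(j + 1) * w + m \<le> M" using J(2) by linarith
      then show "\<exists>g. p0 + j * w \<le> g \<and> g < p0 + (j + 1) * w \<and> e \<le> card (?I g)"
        unfolding Z_def p0_def by (rule good_vertex_in_window[OF v z vz dz light])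
    qed
    from bchoice[OF this] obtain g
      where "\<forall>j\<in>{..<J}. p0 + j * w \<le> g j \<and> g j < p0 + (j + 1) * w \<and> e \<le> card (?I (g j))" ..
    then have g: "p0 + j * w \<le> g j \<and> g j < p0 + (j + 1) * w \<and> e \<le> card (?I (g j))" if "j < J" for j
      using that by simp
    define C where "C j = (\<lambda>i. {Z ! i, Z ! g j}) ` ?I (g j)" for j
    have glen: "g j < length Z" if "j < J" for j
    proof -
      have "(j + 1) * w \<le> J * w" using that by (intro mult_right_mono) auto
      then show ?thesis using g[OF that] len by linarith
    qed
    have "C j \<subseteq> E \<and> e \<le> card (C j)" if "j < J" for j
    proof -
      have "inj_on (\<lambda>i. {Z ! i, Z ! g j}) (?I (g j))"
      proof (rule inj_onI)
        fix i i' assume i: "i \<in> ?I (g j)" "i' \<in> ?I (g j)" "{Z ! i, Z ! g j} = {Z ! i', Z ! g j}"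
        then have "Z ! i = Z ! i'" by (auto simp: doubleton_eq_iff)
        then show "i = i'" using dZ i(1,2) glen[OF that] by (simp add: nth_eq_iff_index_eq)
      qed
      then have "card (C j) = card (?I (g j))" unfolding C_def by (rule card_image)
      then show ?thesis using g[OF that] by (auto simp: C_def)
    qed
    moreover have "\<exists>xs. is_cycle (F \<union> F') xs \<and> m \<le> length xs" if hit: "\<And>j. j < J \<Longrightarrow> F' \<inter> C j \<noteq> {}" for F'
    proof -
      have "\<exists>xs. is_cycle (F \<union> F') xs \<and> (J - 1) * w \<le> 2 * length xs"
      proof (rule zigzag_cycle[OF dZ _ w len J(1)])
        show "successively (\<lambda>a b. {a, b} \<in> F \<union> F') Z" unfolding Z_def by (rule path_stem[OF z])
        fix j assume j: "j < J"
        from hit[OF j] obtain t where "t + 6 * w \<le> g j" "{Z ! t, Z ! g j} \<in> F'" by (auto simp: C_def)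
        then show "\<exists>g t. p0 + j * w \<le> g \<and> g < p0 + (j + 1) * w \<and> t + 6 * w \<le> g \<and> {Z ! t, Z ! g} \<in> F \<union> F'"
          using g[OF j] by blast
      qed
      then obtain xs where "is_cycle (F \<union> F') xs" "(J - 1) * w \<le> 2 * length xs" by blast
      \<comment> \<open>The zigzag covers half of the path, and the path was chosen long enough to
        pay for this factor.\<close>
      moreover from this have "m \<le> length xs" using J(3) by linarith
      ultimately show ?thesis by blast
    qed
    moreover have "card (C ` {..<J}) \<le> J" using card_image_le[of "{..<J}" C] by simp
    ultimately show ?thesis by (intro exI[of _ "C ` {..<J}"]) auto
  qed
qed

text \<open>Condition on the first copy. Either its search had at least \<open>x\<close> failures,
  or the second copy must miss one of at most \<open>J\<close> sets, each with at least
  \<open>e\<close> edges.\<close>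

lemma prob_no_long_cycle:
  fixes V :: "'a set" and k e m w b M J x :: nat and p q :: real
  assumes fin: "finite V" and sg: "simple_graph V E" and C4: "C4_free E"
    and deg: "\<forall>v\<in>V. k \<le> card (nbrs E v)"
    and kst: "(m + 9 * w) * ((k - 3 * e) + b) < (k - 3 * e)\<^sup>2 * b"
    and w: "0 < w" and m: "2 \<le> m" and bw: "2 * b \<le> w"
    and J: "0 < J" "J * w + m \<le> M" "2 * m \<le> (J - 1) * w"
    and few: "\<forall>nf pr mr. e * nf \<le> 2 * x \<longrightarrow> pr \<le> nf + b * (2 * card V div w + 1) \<longrightarrow> w * mr \<le> pr \<longrightarrow>
      (pr + M * mr) * (M + 1 + w) + 2 * (M + 1) * nf < w * card V"
    and q: "0 \<le> q" "q \<le> 1" "1 - p = (1 - q)\<^sup>2"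
  shows "measure_pmf.prob (random_subgraph E p) {F. \<not> (\<exists>xs. is_cycle F xs \<and> m \<le> length xs)}
    \<le> 2 ^ card V * (1 - q / 2) ^ x + real J * (1 - q) ^ e"
proof -
  let ?bad = "{F. \<not> (\<exists>xs. is_cycle F xs \<and> m \<le> length xs)}"
  let ?R = "random_subgraph E q"
  let ?fail = "{F. x \<le> card (snd (dfs_run V E F))}"
  have "E \<subseteq> Pow V" using sg by (auto simp: simple_graph_def)
  then have fE: "finite E" using fin by (simp add: finite_subset)
  have second: "measure_pmf.prob ?R {F'. F \<union> F' \<in> ?bad} \<le> real J * (1 - q) ^ e" if F: "F \<notin> ?fail" for F
  proof -
    have "card (snd (dfs_run V E F)) \<le> x" using F by simp
    from hitting_family[OF fin sg C4 deg this kst w m bw J few]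
    obtain \<C> where C: "finite \<C>" "card \<C> \<le> J" "\<forall>C\<in>\<C>. C \<subseteq> E \<and> e \<le> card C"
      and hit: "\<forall>F'. (\<forall>C\<in>\<C>. F' \<inter> C \<noteq> {}) \<longrightarrow> (\<exists>xs. is_cycle (F \<union> F') xs \<and> m \<le> length xs)"
      by (elim exE conjE)
    have "measure_pmf.prob ?R {F'. F \<union> F' \<in> ?bad} \<le> measure_pmf.prob ?R (\<Union>C\<in>\<C>. {F'. F' \<inter> C = {}})"
    proof (rule measure_pmf.finite_measure_mono)
      show "{F'. F \<union> F' \<in> ?bad} \<subseteq> (\<Union>C\<in>\<C>. {F'. F' \<inter> C = {}})"
      proof
        fix F' assume "F' \<in> {F'. F \<union> F' \<in> ?bad}"
        then have "\<not> (\<forall>C\<in>\<C>. F' \<inter> C \<noteq> {})" using spec[OF hit, of F'] by blast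
        then show "F' \<in> (\<Union>C\<in>\<C>. {F'. F' \<inter> C = {}})" by blast
      qed
    qed simp
    also have "\<dots> \<le> (\<Sum>C\<in>\<C>. measure_pmf.prob ?R {F'. F' \<inter> C = {}})"
      using C(1) by (intro measure_pmf.finite_measure_subadditive_finite) auto
    also have "\<dots> \<le> (\<Sum>C\<in>\<C>. (1 - q) ^ e)"
    proof (rule sum_mono)
      fix C assume "C \<in> \<C>"
      then have C': "C \<subseteq> E" "e \<le> card C" using C by auto
      have "measure_pmf.prob ?R {F'. F' \<inter> C = {}} = (1 - q) ^ card C"
        by (rule prob_random_subgraph_avoids[OF fE C'(1) q(1,2)])
      also have "\<dots> \<le> (1 - q) ^ e" using C'(2) q by (intro power_decreasing) auto
      finally show "measure_pmf.prob ?R {F'. F' \<inter> C = {}} \<le> (1 - q) ^ e" .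
    qed
    also have "\<dots> = real (card \<C>) * (1 - q) ^ e" by simp
    also have "\<dots> \<le> real J * (1 - q) ^ e" using C(2) q by (intro mult_right_mono) auto
    finally show ?thesis .
  qed
  have nonneg: "0 \<le> real J * (1 - q) ^ e" using q by simp
  have "emeasure (random_subgraph E p) ?bad = (\<integral>\<^sup>+F. emeasure ?R {F'. F \<union> F' \<in> ?bad} \<partial>measure_pmf ?R)"
    unfolding random_subgraph_union[OF fE q] emeasure_bind_pmf emeasure_map_pmf vimage_def ..
  also have "\<dots> \<le> (\<integral>\<^sup>+F. indicator ?fail F + ennreal (real J * (1 - q) ^ e) \<partial>measure_pmf ?R)"
  proof (rule nn_integral_mono)
    fix F
    show "emeasure ?R {F'. F \<union> F' \<in> ?bad} \<le> indicator ?fail F + ennreal (real J * (1 - q) ^ e)"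
    proof (cases "F \<in> ?fail")
      case True
      have "emeasure ?R {F'. F \<union> F' \<in> ?bad} \<le> 1" by (rule measure_pmf.emeasure_le_1)
      also have "\<dots> \<le> indicator ?fail F + ennreal (real J * (1 - q) ^ e)" using True by simp
      finally show ?thesis .
    next
      case False
      then show ?thesis using second[OF False]
        by (simp add: measure_pmf.emeasure_eq_measure ennreal_leI)
    qed
  qed
  also have "\<dots> = emeasure ?R ?fail + ennreal (real J * (1 - q) ^ e)"
    by (subst nn_integral_add) simp_all
  also have "\<dots> = ennreal (measure_pmf.prob ?R ?fail + real J * (1 - q) ^ e)"
    using nonneg by (simp add: measure_pmf.emeasure_eq_measure ennreal_plus)
  finally have "measure_pmf.prob (random_subgraph E p) ?bad \<le> measure_pmf.prob ?R ?fail + real J * (1 - q) ^ e"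
    unfolding measure_pmf.emeasure_eq_measure using nonneg by (subst (asm) ennreal_le_iff) auto
  also have "measure_pmf.prob ?R ?fail \<le> 2 ^ card V * (1 - q / 2) ^ x"
    by (rule prob_dfs_run_failures[OF q(1,2) fin sg])
  finally show ?thesis by simp
qed

section \<open>Choice of the parameters\<close>

text \<open>The Kovari-Sos-Turan count with both sides equal to \<open>V\<close>, divided by
  \<open>card V\<close>.\<close>

lemma C4_free_card_ge:
  assumes "finite V" "V \<noteq> {}" "simple_graph V E" "C4_free E"
    and "\<And>v. v \<in> V \<Longrightarrow> k \<le> card (nbrs E v)"
  shows "k\<^sup>2 \<le> k + card V"
proof -
  have "k\<^sup>2 * card V \<le> card V * (k + card V)"
    using assms C4_free_common_nbrs[OF assms(1,3,4)] nbrs_subset[OF assms(3)]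
    by (intro card_mult_le_of_intersections[of V V "nbrs E"]) auto
  then show ?thesis using assms(1,2) by (simp add: card_gt_0_iff)
qed

text \<open>The scales are \<open>e\<close> about \<open>d * k\<close>, \<open>w\<close> about
  \<open>d * k\<^sup>2\<close>, \<open>m\<close> about \<open>(1 - h) * k\<^sup>2\<close>,
  \<open>b\<close> of order \<open>k / h\<close> and \<open>x\<close> about
  \<open>g * n * k\<close>, with \<open>g\<close> tiny compared to \<open>d\<close> and
  \<open>d\<close> to \<open>h\<close>. A path of length \<open>6 * k\<^sup>2\<close> leaves room
  for \<open>m\<close> levels at its end and for segments of total length above
  \<open>2 * m\<close>.\<close>

lemma parameters:
  fixes h d g :: real and k n :: nat
  assumes h: "0 < h" "h \<le> 1 / 2" and d: "d = h / 100" and g: "g = d ^ 3 / 16000"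
    and k: "30000 / (h * d ^ 3) \<le> k" and n: "k\<^sup>2 \<le> k + n"
  defines "e \<equiv> nat \<lfloor>d * k\<rfloor>" and "w \<equiv> nat \<lfloor>d * k\<^sup>2\<rfloor>" and "m \<equiv> nat \<lceil>(1 - h) * k\<^sup>2\<rceil>"
    and "b \<equiv> nat \<lceil>2 * real k / h\<rceil>" and "M \<equiv> 6 * k\<^sup>2" and "x \<equiv> nat \<lceil>g * n * k\<rceil>"
  defines "J \<equiv> (M - m) div w"
  shows "(m + 9 * w) * ((k - 3 * e) + b) < (k - 3 * e)\<^sup>2 * b"
    and "0 < w" "2 \<le> m" "2 * b \<le> w" "0 < J" "J * w + m \<le> M" "2 * m \<le> (J - 1) * w"
    and "\<And>nf pr mr. e * nf \<le> 2 * x \<Longrightarrow> pr \<le> nf + b * (2 * n div w + 1) \<Longrightarrow> w * mr \<le> pr \<Longrightarrow>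
      (pr + M * mr) * (M + 1 + w) + 2 * (M + 1) * nf < w * n"
    and "real J \<le> 12 / d" "d * k / 2 \<le> e" "g * n * k \<le> x" "(1 - h) * (real k)\<^sup>2 \<le> m" "1 \<le> n"
proof -
  define R where "R = real k"
  have d0: "0 < d" "d \<le> 1 / 200" using h d by auto
  have hd3: "0 < h * d ^ 3" using h d0 by simp
  \<comment> \<open>The one largeness condition on \<open>k\<close>; the products with weaker
    factors that follow absorb all rounding errors.\<close>
  have K: "30000 \<le> R * (h * d ^ 3)" using k hd3 by (simp add: divide_le_eq R_def)
  have R0: "0 \<le> R" by (simp add: R_def)
  have large: "30000 \<le> R * t" if "h * d ^ 3 \<le> t" for t
    using K mult_left_mono[OF that R0] by linarith
  have d2: "d ^ 2 \<le> 1" "d ^ 3 \<le> 1" using d0 by (auto intro!: power_le_one)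
  have Rd3: "30000 \<le> R * d ^ 3" using h d0 by (intro large) (auto intro!: mult_left_le_one_le)
  have Rhd: "30000 \<le> R * (h * d)"
  proof (rule large)
    have "d ^ 3 = d * d ^ 2" by (simp add: power3_eq_cube power2_eq_square)
    then have "d ^ 3 \<le> d" using d2 d0 by (simp add: mult_left_le)
    then show "h * d ^ 3 \<le> h * d" using h by simp
  qed
  have Rd: "30000 \<le> R * d" and Rh: "30000 \<le> R * h" and R: "30000 \<le> R"
  proof -
    have "h * d \<le> d" "h * d \<le> h" "h * d \<le> 1" using h d0 by (auto simp: mult_le_one)
    then have "R * (h * d) \<le> R * d" "R * (h * d) \<le> R * h" "R * (h * d) \<le> R * 1"
      using R0 by (intro mult_left_mono; simp)+
    then show "30000 \<le> R * d" "30000 \<le> R * h" "30000 \<le> R" using Rhd by linarith+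
  qed
  have R2: "R \<le> R\<^sup>2" using R by (simp add: power2_eq_square)
  have dR2: "30000 \<le> d * R\<^sup>2"
  proof -
    have "R * d * 1 \<le> R * d * R" using Rd R by (intro mult_left_mono) auto
    then show ?thesis using Rd by (simp add: power2_eq_square algebra_simps)
  qed
  have e: "d * R / 2 \<le> e" "real e \<le> d * R"
    using Rd d0 R0 unfolding e_def R_def[symmetric] by (auto simp: mult.commute) linarith
  have w: "d * R\<^sup>2 / 2 \<le> w" "real w \<le> d * R\<^sup>2"
    using dR2 unfolding w_def of_nat_power R_def[symmetric] by (auto simp: of_nat_floor) linarith
  have mlow: "(1 - h) * R\<^sup>2 \<le> m" unfolding m_def of_nat_power R_def[symmetric] by linarith
  have m: "real m \<le> (1 - h) * R\<^sup>2 + 1"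
  proof -
    have "0 \<le> (1 - h) * R\<^sup>2" using h by simp
    then show ?thesis unfolding m_def of_nat_power R_def[symmetric] by linarith
  qed
  have Rbh: "1 \<le> R / h" using h R by (simp add: le_divide_eq)
  have b: "2 * R / h \<le> b" unfolding b_def R_def[symmetric] by linarith
  have b2: "real b \<le> 3 * R / h"
  proof -
    have "real b \<le> 2 * R / h + 1" using Rbh unfolding b_def R_def[symmetric] by linarith
    moreover have "3 * R / h = 2 * R / h + R / h" by (simp add: add_divide_distrib[symmetric])
    ultimately show ?thesis using Rbh by linarith
  qed
  have n2: "R\<^sup>2 / 2 \<le> n"
  proof -
    have "R\<^sup>2 \<le> R + real n" using n unfolding R_def by (metis of_nat_add of_nat_mono of_nat_power)
    moreover have "2 * R \<le> R\<^sup>2" using R by (simp add: power2_eq_square)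
    ultimately show ?thesis by linarith
  qed
  have n1: "1 \<le> real n" using n2 R2 R by linarith
  have x: "g * n * R \<le> x" unfolding x_def R_def[symmetric] by linarith
  have gR: "1 \<le> g * R" using Rd3 unfolding g by (simp add: mult.commute)
  have x2: "real x \<le> 2 * g * n * R"
  proof -
    have "1 * 1 \<le> (g * R) * n" using gR n1 by (intro mult_mono) auto
    then have "1 \<le> g * n * R" by (simp add: mult.commute mult.left_commute)
    then show ?thesis unfolding x_def R_def[symmetric] by linarith
  qed

  have hR2: "h * R\<^sup>2 = 100 * (d * R\<^sup>2)" by (simp add: d)
  have m': "real m \<le> R\<^sup>2" using m hR2 dR2 by (simp add: algebra_simps)
  then have mk: "m \<le> k\<^sup>2" unfolding R_def by (simp flip: of_nat_power)
  have w': "real w \<le> R\<^sup>2" using w(2) mult_right_mono[of d 1 "R\<^sup>2"] d0 by simp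
  then have wk: "w \<le> k\<^sup>2" unfolding R_def by (simp flip: of_nat_power)
  show w_pos: "0 < w" using w(1) dR2 by linarith
  show "2 \<le> m"
  proof -
    have "1 / 2 * R\<^sup>2 \<le> (1 - h) * R\<^sup>2" using h by (intro mult_right_mono) auto
    then show ?thesis using mlow R2 R by linarith
  qed
  show "1 \<le> n" "g * n * k \<le> x" "d * k / 2 \<le> e" "(1 - h) * (real k)\<^sup>2 \<le> m"
    using n1 x e mlow by (auto simp: R_def)
  show "2 * b \<le> w"
  proof -
    have "6 * R / h \<le> d * R\<^sup>2 / 2"
    proof -
      have "12 * R \<le> R * (h * d) * R" using Rhd R0 by (intro mult_right_mono) auto
      then show ?thesis using h by (simp add: divide_le_eq power2_eq_square algebra_simps)
    qed
    then have "real (2 * b) \<le> w" using b2 w(1) by simp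
    then show ?thesis by linarith
  qed
  have mM: "m + w \<le> M" "M - m \<ge> 5 * k\<^sup>2" using mk wk by (auto simp: M_def)
  show J_pos: "0 < J" unfolding J_def using mM w_pos by (simp add: div_greater_zero_iff)
  have Jw: "J * w \<le> M - m" unfolding J_def by simp
  then show "J * w + m \<le> M" using mM by linarith
  show "2 * m \<le> (J - 1) * w"
  proof -
    have "M - m < J * w + w" unfolding J_def using dividend_less_div_times[OF w_pos, of "M - m"] by linarith
    moreover have "J * w = (J - 1) * w + w" using J_pos by (simp add: diff_mult_distrib)
    ultimately show ?thesis using mM mk wk by linarith
  qed
  show "real J \<le> 12 / d"
  proof -
    have "real (J * w) \<le> real (6 * k\<^sup>2)" using Jw by (intro of_nat_mono) (simp add: M_def)
    then have "real J * w \<le> 6 * R\<^sup>2" by (simp add: R_def)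
    moreover have "real J * (d * R\<^sup>2 / 2) \<le> real J * w" using w by (intro mult_left_mono) auto
    ultimately have "(real J * d) * R\<^sup>2 \<le> 12 * R\<^sup>2" by simp
    then have "real J * d \<le> 12" using R by simp
    then show ?thesis using d0 by (simp add: le_divide_eq)
  qed
  show "(m + 9 * w) * ((k - 3 * e) + b) < (k - 3 * e)\<^sup>2 * b"
  proof -
    define \<kappa> where "\<kappa> = k - 3 * e"
    have "d * R \<le> 1 / 200 * R" using d0 R0 by (intro mult_right_mono) auto
    then have "3 * real e \<le> R" using e R0 by linarith
    then have "3 * e \<le> k" unfolding R_def by linarith
    then have \<kappa>: "real \<kappa> = R - 3 * e" by (simp add: \<kappa>_def R_def)
    have \<kappa>1: "real \<kappa> \<le> R" "(1 - 3 * d) * R \<le> \<kappa>" using \<kappa> e by (auto simp: algebra_simps)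
    have \<kappa>2: "(1 - 6 * d) * R\<^sup>2 \<le> (real \<kappa>)\<^sup>2"
    proof -
      have "(1 - 6 * d) * R\<^sup>2 \<le> (1 - 3 * d)\<^sup>2 * R\<^sup>2"
        by (intro mult_right_mono) (auto simp: power2_eq_square algebra_simps)
      also have "\<dots> = ((1 - 3 * d) * R)\<^sup>2" by (simp add: power_mult_distrib)
      also have "\<dots> \<le> (real \<kappa>)\<^sup>2" using \<kappa>1 d0 R0 by (intro power_mono) auto
      finally show ?thesis .
    qed
    have b_pos: "0 < real b" using b Rbh by simp
    \<comment> \<open>From \<open>h = 100 * d\<close>: the sum is at most
      \<open>1 - 100 * d + 9 * d\<close> times \<open>R\<^sup>2\<close>, and one more
      \<open>d * R\<^sup>2\<close> absorbs the rounding of \<open>m\<close>.\<close>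
    have Y: "real m + 9 * w \<le> (1 - 90 * d) * R\<^sup>2"
      using m w(2) hR2 dR2 by (simp add: algebra_simps)
    have "(real m + 9 * w) * (\<kappa> + real b) \<le> (1 - 90 * d) * R\<^sup>2 * (R + b)"
      using Y \<kappa>1 d0 by (intro mult_mono) auto
    also have "\<dots> < (1 - 6 * d) * R\<^sup>2 * b"
    proof -
      \<comment> \<open>The size of \<open>b\<close> makes the extra \<open>R\<close> at most
        \<open>50 * d * b\<close>, less than the gap \<open>84 * d * b\<close> between the two
        factors.\<close>
      have "2 * R \<le> h * b" using b h by (simp add: divide_le_eq mult.commute)
      then have "2 * R \<le> 100 * (d * b)" by (simp add: d)
      moreover have "(1 - 90 * d) * R \<le> R" using d0 R0 by (simp add: mult_left_le_one_le)
      ultimately have "(1 - 90 * d) * R < 84 * (d * b)" using R by linarith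
      then have "(1 - 90 * d) * (R + b) < (1 - 6 * d) * b" by (simp add: algebra_simps)
      then have "R\<^sup>2 * ((1 - 90 * d) * (R + b)) < R\<^sup>2 * ((1 - 6 * d) * b)"
        using R by (intro mult_strict_left_mono) auto
      then show ?thesis by (simp add: algebra_simps)
    qed
    also have "\<dots> \<le> (real \<kappa>)\<^sup>2 * b" using \<kappa>2 by (intro mult_right_mono) auto
    finally have "real ((m + 9 * w) * (\<kappa> + b)) < real (\<kappa>\<^sup>2 * b)" by simp
    then show ?thesis unfolding \<kappa>_def[symmetric] by linarith
  qed
  fix nf pr mr :: nat
  assume nf: "e * nf \<le> 2 * x" and pr: "pr \<le> nf + b * (2 * n div w + 1)" and mr: "w * mr \<le> pr"
  have R2pos: "0 < R\<^sup>2" using R by simp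
  have nf': "real nf \<le> d\<^sup>2 * n / 2000"
  proof -
    have "real (e * nf) \<le> real (2 * x)" using nf by (rule of_nat_mono)
    then have "real e * nf \<le> 4 * g * n * R" using x2 by simp
    moreover have "d * R / 2 * nf \<le> real e * nf" using e by (intro mult_right_mono) auto
    ultimately have "R * (d * nf) \<le> R * (8 * g * n)" by (simp add: algebra_simps)
    then have "d * nf \<le> 8 * g * n" using R by simp
    \<comment> \<open>Here the constant 16000 in \<open>g\<close> is used.\<close>
    also have "\<dots> = d * (d\<^sup>2 * n / 2000)" by (simp add: g power3_eq_cube power2_eq_square)
    finally show ?thesis using d0 by simp
  qed
  have pf: "real (b * (2 * n div w + 1)) \<le> d\<^sup>2 * n / 2000"
  proof -
    have "real (2 * n div w) \<le> real (2 * n) / w" by (rule of_nat_div_le_of_nat)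
    also have "\<dots> \<le> real (2 * n) / (d * R\<^sup>2 / 2)" using w dR2 by (intro divide_left_mono) auto
    finally have 1: "real (2 * n div w) \<le> 4 * real n / (d * R\<^sup>2)" by simp
    have 2: "1 \<le> n / (d * R\<^sup>2)"
    proof -
      have "d * R\<^sup>2 \<le> 1 / 2 * R\<^sup>2" using d0 by (intro mult_right_mono) auto
      then show ?thesis using n2 dR2 by (simp add: le_divide_eq)
    qed
    have 3: "real (2 * n div w + 1) \<le> 5 * real n / (d * R\<^sup>2)"
    proof -
      have "real (2 * n div w + 1) = real (2 * n div w) + 1" by simp
      also have "\<dots> \<le> 4 * real n / (d * R\<^sup>2) + real n / (d * R\<^sup>2)" using 1 2 by (rule add_mono)
      also have "\<dots> = 5 * real n / (d * R\<^sup>2)" by (simp add: add_divide_distrib[symmetric])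
      finally show ?thesis .
    qed
    have "real (b * (2 * n div w + 1)) = real b * real (2 * n div w + 1)" by (rule of_nat_mult)
    also have "\<dots> \<le> (3 * R / h) * (5 * real n / (d * R\<^sup>2))" using b2 3 h R by (intro mult_mono) auto
    also have "\<dots> = 15 * n / (h * d * R)" using R by (simp add: field_simps power2_eq_square)
    also have "\<dots> \<le> d\<^sup>2 * n / 2000"
    proof -
      \<comment> \<open>The inequality needed is
        \<open>15 / (h * d * R) \<le> d\<^sup>2 / 2000\<close>, which is the assumed lower bound on
        \<open>k\<close>.\<close>
      have "30000 * real n \<le> R * (h * d ^ 3) * n" using K by (intro mult_right_mono) auto
      then show ?thesis using h d0 R
        by (simp add: divide_le_eq) (simp add: power3_eq_cube power2_eq_square algebra_simps)
    qed
    finally show ?thesis .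
  qed
  have pr': "real pr \<le> d\<^sup>2 * n / 1000"
  proof -
    have "real pr \<le> real (nf + b * (2 * n div w + 1))" using pr by (rule of_nat_mono)
    also have "\<dots> = real nf + real (b * (2 * n div w + 1))" by (rule of_nat_add)
    finally show ?thesis using nf' pf by linarith
  qed
  have mr': "d * R\<^sup>2 * mr \<le> 2 * pr"
  proof -
    have "real (w * mr) \<le> pr" using mr by (rule of_nat_mono)
    moreover have "d * R\<^sup>2 / 2 * mr \<le> real w * mr" using w by (intro mult_right_mono) auto
    ultimately show ?thesis by simp
  qed
  have first: "real pr + 6 * R\<^sup>2 * mr \<le> 13 * d * n / 1000"
  proof -
    have "d * (real pr + 6 * R\<^sup>2 * mr) \<le> d * pr + 12 * pr" using mr' by (simp add: algebra_simps)
    also have "\<dots> \<le> 13 * real pr" using d0 by (simp add: mult_left_le_one_le)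
    also have "\<dots> \<le> d * (13 * d * n / 1000)" using pr' by (simp add: power2_eq_square)
    finally show ?thesis using d0 by simp
  qed
  have "(real pr + 6 * R\<^sup>2 * mr) * (6 * R\<^sup>2 + 1 + w) + 2 * (6 * R\<^sup>2 + 1) * nf
      \<le> (13 * d * n / 1000) * (8 * R\<^sup>2) + 2 * (7 * R\<^sup>2) * (d * n / 2000)"
  proof (intro add_mono mult_mono first)
    show "6 * R\<^sup>2 + 1 + real w \<le> 8 * R\<^sup>2" using w' R2 R by linarith
    show "6 * R\<^sup>2 + 1 \<le> 7 * R\<^sup>2" using R2 R by linarith
    have "d\<^sup>2 * n \<le> d * n" using d0 by (intro mult_right_mono) (auto simp: power2_eq_square mult_left_le)
    then show "real nf \<le> d * n / 2000" using nf' by linarith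
  qed (use d0 in auto)
  \<comment> \<open>The coefficients add up to 0.104 + 0.007, well below 1/2.\<close>
  also have "\<dots> < d * R\<^sup>2 / 2 * n"
  proof -
    have "0 < d * R\<^sup>2 * n" using d0 R2pos n1 by simp
    then show ?thesis by (simp add: algebra_simps)
  qed
  also have "\<dots> \<le> real w * n" using w by (intro mult_right_mono) auto
  finally have "real ((pr + M * mr) * (M + 1 + w) + 2 * (M + 1) * nf) < real (w * n)"
    by (simp add: M_def R_def algebra_simps)
  then show "(pr + M * mr) * (M + 1 + w) + 2 * (M + 1) * nf < w * n" by linarith
qed

section \<open>Passing to the limit\<close>

lemma power_one_minus_le_exp:
  fixes t :: real
  assumes "0 \<le> t" "t \<le> 1"
  shows "(1 - t) ^ n \<le> exp (- (t * n))"
proof -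
  have "(1 - t) ^ n \<le> exp (- t) ^ n"
    using assms exp_ge_add_one_self[of "- t"] by (intro power_mono) auto
  also have "\<dots> = exp (- (t * n))" by (simp add: exp_of_nat_mult[symmetric] mult.commute)
  finally show ?thesis .
qed

theorem theorem1p8:
  fixes p :: "nat \<Rightarrow> real" and \<eta> :: real
  assumes "\<And>k. 0 \<le> p k \<and> p k \<le> 1"
    and "filterlim (\<lambda>k. p k * real k) at_top sequentially"
    and "\<eta> > 0"
  shows "\<forall>\<epsilon>>0. \<forall>\<^sub>F k in sequentially. \<forall>(V :: 'a set) E.
           finite V \<and> V \<noteq> {} \<and> simple_graph V E \<and> C4_free E \<and> min_degree V E = k \<longrightarrow>
           measure_pmf.prob (random_subgraph E (p k))
             {F. \<exists>xs. is_cycle F xs \<and> real (length xs) \<ge> (1 - \<eta>) * (real k)\<^sup>2} \<ge> 1 - \<epsilon>"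
proof (intro allI impI)
  fix \<epsilon> :: real
  assume \<epsilon>: "0 < \<epsilon>"
  \<comment> \<open>A smaller \<open>\<eta>\<close> only asks for a longer cycle, so it may be
    capped at 1/2.\<close>
  define h where "h = min \<eta> (1 / 2)"
  define d where "d = h / 100"
  define g where "g = d ^ 3 / 16000"
  have h: "0 < h" "h \<le> 1 / 2" "h \<le> \<eta>" using assms(3) by (auto simp: h_def)
  have d: "0 < d" using h by (simp add: d_def)
  have g: "0 < g" using d by (simp add: g_def)
  \<comment> \<open>The second and third entries make each of the two error terms at most
    \<open>\<epsilon> / 2\<close>; the first makes the exponent of the failure bound decrease with
    the number of vertices. None of them depends on the graph, which gives uniformity.\<close>
  define Q where "Q = Max {4 / g, 4 * (1 - ln (\<epsilon> / 2)) / g, 4 * (ln (12 / d) - ln (\<epsilon> / 2)) / d}"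
  have "\<forall>\<^sub>F k in sequentially. Q \<le> p k * real k"
    using assms(2) by (auto simp: filterlim_at_top)
  moreover have "\<forall>\<^sub>F k in sequentially. 30000 / (h * d ^ 3) \<le> real k"
    using filterlim_real_sequentially by (auto simp: filterlim_at_top)
  ultimately show "\<forall>\<^sub>F k in sequentially. \<forall>(V :: 'a set) E.
           finite V \<and> V \<noteq> {} \<and> simple_graph V E \<and> C4_free E \<and> min_degree V E = k \<longrightarrow>
           measure_pmf.prob (random_subgraph E (p k))
             {F. \<exists>xs. is_cycle F xs \<and> real (length xs) \<ge> (1 - \<eta>) * (real k)\<^sup>2} \<ge> 1 - \<epsilon>"
  proof eventually_elim
    case (elim k)
    have Q: "4 / g \<le> p k * k" "4 * (1 - ln (\<epsilon> / 2)) / g \<le> p k * k"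
      "4 * (ln (12 / d) - ln (\<epsilon> / 2)) / d \<le> p k * k"
      using elim(1) by (auto simp: Q_def)
    then have Qg: "4 \<le> p k * k * g" "4 * (1 - ln (\<epsilon> / 2)) \<le> p k * k * g"
      and Qd: "4 * (ln (12 / d) - ln (\<epsilon> / 2)) \<le> p k * k * d"
      using g d by (simp_all only: pos_divide_le_eq)
    \<comment> \<open>The solution of \<open>1 - p k = (1 - q)\<^sup>2\<close> in the unit
      interval.\<close>
    define q where "q = 1 - sqrt (1 - p k)"
    have q: "0 \<le> q" "q \<le> 1" "1 - p k = (1 - q)\<^sup>2"
      using assms(1)[of k] by (auto simp: q_def)
    have "p k = 2 * q - q\<^sup>2" using q(3) by (simp add: power2_eq_square algebra_simps)
    then have pq: "p k \<le> 2 * q" using zero_le_power2[of q] by linarith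
    show ?case
    proof (intro allI impI, elim conjE)
      fix V :: "'a set" and E
      assume V: "finite V" "V \<noteq> {}" and sg: "simple_graph V E" and C4: "C4_free E" and k: "min_degree V E = k"
      define n where "n = card V"
      define e where "e = nat \<lfloor>d * k\<rfloor>"
      define w where "w = nat \<lfloor>d * k\<^sup>2\<rfloor>"
      define m where "m = nat \<lceil>(1 - h) * k\<^sup>2\<rceil>"
      define b where "b = nat \<lceil>2 * real k / h\<rceil>"
      define M where "M = 6 * k\<^sup>2"
      define x where "x = nat \<lceil>g * n * k\<rceil>"
      define J where "J = (M - m) div w"
      have deg: "\<forall>v\<in>V. k \<le> card (nbrs E v)"
        using min_degree_le_card_nbrs[OF V(1) sg] k by auto
      then have nk: "k\<^sup>2 \<le> k + n" unfolding n_def using C4_free_card_ge[OF V sg C4] by blast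
      note par = parameters[OF h(1,2) d_def g_def elim(2) nk,
          folded e_def w_def m_def b_def M_def x_def, folded J_def]
      have few: "\<forall>nf pr mr. e * nf \<le> 2 * x \<longrightarrow> pr \<le> nf + b * (2 * card V div w + 1) \<longrightarrow> w * mr \<le> pr \<longrightarrow>
          (pr + M * mr) * (M + 1 + w) + 2 * (M + 1) * nf < w * card V"
        using par(8) unfolding n_def by blast
      let ?bad = "{F. \<not> (\<exists>xs. is_cycle F xs \<and> m \<le> length xs)}"
      have "measure_pmf.prob (random_subgraph E (p k)) ?bad
          \<le> 2 ^ card V * (1 - q / 2) ^ x + real J * (1 - q) ^ e"
        by (rule prob_no_long_cycle[OF V(1) sg C4 deg par(1-7) few q])
      also have "2 ^ card V * (1 - q / 2) ^ x \<le> \<epsilon> / 2"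
      proof -
        have "(2::real) ^ card V \<le> exp 1 ^ card V"
          using exp_ge_add_one_self[of 1] by (intro power_mono) auto
        also have "\<dots> = exp (real n)" by (simp add: exp_of_nat_mult[symmetric] n_def)
        finally have "2 ^ card V * (1 - q / 2) ^ x \<le> exp (real n) * exp (- (q / 2 * x))"
          using power_one_minus_le_exp[of "q / 2" x] q by (intro mult_mono) auto
        also have "\<dots> = exp (n - q / 2 * x)" by (simp add: exp_add[symmetric])
        also have "\<dots> \<le> exp (ln (\<epsilon> / 2))"
        proof (rule iffD2[OF exp_le_cancel_iff])
          have "n * (p k * k * g / 4) \<le> n * (2 * q * k * g / 4)"
            using pq g by (intro mult_left_mono divide_right_mono mult_right_mono) auto
          also have "\<dots> = q / 2 * (g * n * k)" by simp
          also have "\<dots> \<le> q / 2 * x" using par(11) q by (intro mult_left_mono) auto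
          finally have "n - q / 2 * x \<le> n * (1 - p k * k * g / 4)" by (simp add: algebra_simps)
          \<comment> \<open>The second factor is at most 0 and \<open>n\<close> is at least 1, so
            the bound becomes independent of the number of vertices.\<close>
          also have "\<dots> \<le> 1 * (1 - p k * k * g / 4)"
            using par(13) Qg(1) by (intro mult_right_mono_neg) auto
          also have "\<dots> \<le> ln (\<epsilon> / 2)" using Qg(2) by simp
          finally show "n - q / 2 * x \<le> ln (\<epsilon> / 2)" .
        qed
        finally show ?thesis using \<epsilon> by simp
      qed
      also have "real J * (1 - q) ^ e \<le> \<epsilon> / 2"
      proof -
        have "real J * (1 - q) ^ e \<le> 12 / d * exp (- (q * e))"
          using par(9) power_one_minus_le_exp[of q e] q d by (intro mult_mono) auto
        also have "\<dots> = exp (ln (12 / d) - q * e)" using d by (simp add: exp_diff exp_minus field_simps)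
        also have "\<dots> \<le> exp (ln (\<epsilon> / 2))"
        proof (rule iffD2[OF exp_le_cancel_iff])
          have "p k * k * d / 4 \<le> 2 * q * k * d / 4"
            using pq d by (intro divide_right_mono mult_right_mono) auto
          also have "\<dots> = q * (d * k / 2)" by simp
          also have "\<dots> \<le> q * e" using par(10) q by (intro mult_left_mono) auto
          finally have "p k * k * d / 4 \<le> q * e" .
          then show "ln (12 / d) - q * e \<le> ln (\<epsilon> / 2)" using Qd by argo
        qed
        finally show ?thesis using \<epsilon> by simp
      qed
      finally have bad: "measure_pmf.prob (random_subgraph E (p k)) ?bad \<le> \<epsilon>" by simp
      have "1 - \<epsilon> \<le> 1 - measure_pmf.prob (random_subgraph E (p k)) ?bad" using bad by simp
      also have "\<dots> = measure_pmf.prob (random_subgraph E (p k)) (UNIV - ?bad)"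
        using measure_pmf.prob_compl[of ?bad "random_subgraph E (p k)"] by simp
      also have "\<dots> \<le> measure_pmf.prob (random_subgraph E (p k))
          {F. \<exists>xs. is_cycle F xs \<and> real (length xs) \<ge> (1 - \<eta>) * (real k)\<^sup>2}"
      proof (rule measure_pmf.finite_measure_mono)
        have "(1 - \<eta>) * (real k)\<^sup>2 \<le> (1 - h) * (real k)\<^sup>2" using h by (intro mult_right_mono) auto
        then have len: "(1 - \<eta>) * (real k)\<^sup>2 \<le> real l" if "m \<le> l" for l
          using par(12) that by linarith
        show "UNIV - ?bad \<subseteq> {F. \<exists>xs. is_cycle F xs \<and> real (length xs) \<ge> (1 - \<eta>) * (real k)\<^sup>2}"
          using len by blast
      qed simp
      finally show "1 - \<epsilon> \<le> measure_pmf.prob (random_subgraph E (p k))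
          {F. \<exists>xs. is_cycle F xs \<and> real (length xs) \<ge> (1 - \<eta>) * (real k)\<^sup>2}" .
    qed
  qed
qed

end
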